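(* Let $p>5$ be a prime number and let $G$ be a finite group. Then $G \cong \mathrm{PSL}(2,5)\times\mathbb{Z}_p$ if and only if $\operatorname{Exp}_{\rho}(G) = \operatorname{Exp}_{\rho}(\mathrm{PSL}(2,5)\times\mathbb{Z}_p)$.
   Context: For a finite group $G$, $o(g)$ denotes the order of $g\in G$ and $\rho(G)=\prod_{g\in G} o(g)$ is the product of the element orders. If $n=p_1^{\alpha_1}\cdots p_k^{\alpha_k}$ with $p_1,\dots,p_k$ distinct primes and all $\alpha_i\ge 1$, then $\operatorname{Exp}(n)=\{\alpha_1,\dots,\alpha_k\}$, regarded as a set (repetitions are not recorded, nor is which exponent belongs to which prime). Set $\operatorname{Exp}_{\rho}(G)=\operatorname{Exp}(\rho(G))$. $\mathbb{Z}_n$ denotes the cyclic group of order $n$. *)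

theory Defs
  imports "HOL-Algebra.Elementary_Groups" "HOL-Algebra.Multiplicative_Group"
    "HOL-Analysis.Determinants" "HOL-Computational_Algebra.Primes"
begin

definition SL :: "('a::comm_ring_1^'n^'n) monoid" where
  "SL = \<lparr>carrier = {A. det A = 1}, monoid.mult = (**), one = mat 1\<rparr>"

definition group_centre :: "('a, 'b) monoid_scheme \<Rightarrow> 'a set" where
  "group_centre G = {z \<in> carrier G. \<forall>g \<in> carrier G. z \<otimes>\<^bsub>G\<^esub> g = g \<otimes>\<^bsub>G\<^esub> z}"

definition PSL :: "('a::comm_ring_1^'n^'n) set monoid" where
  "PSL = SL Mod group_centre SL"

text \<open>The numeral type \<open>5\<close> carries the ring of integers modulo 5, that is, the field with five
  elements (the library only provides its commutative ring instance); the numeral type \<open>2\<close> merely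
  indexes the rows and columns.\<close>

abbreviation PSL_2_5 :: "(5^2^2) set monoid" where
  "PSL_2_5 \<equiv> PSL"

definition rho :: "('a, 'b) monoid_scheme \<Rightarrow> nat" where
  "rho G = (\<Prod>g \<in> carrier G. group.ord G g)"

definition Exp :: "nat \<Rightarrow> nat set" where
  "Exp n = (\<lambda>q. multiplicity q n) ` prime_factors n"

definition Exp_rho :: "('a, 'b) monoid_scheme \<Rightarrow> nat set" where
  "Exp_rho G = Exp (rho G)"

end

theory Submission
  imports Defs "HOL-Algebra.Sym_Groups" "HOL-Algebra.Group_Action" "HOL-Algebra.Sylow" "HOL-Number_Theory.Cong"
begin

text \<open>The exponent of a prime \<open>q\<close> in \<open>\<rho>(G)\<close> is \<open>e\<^sub>q = \<Sum>\<^sub>g v\<^sub>q(ord g)\<close>. Writing every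
  \<open>g\<close> as a product of commuting elements of \<open>q\<close>-power order and of order prime to \<open>q\<close> shows that the
  \<open>q'\<close>-part of \<open>|G|\<close> divides \<open>e\<^sub>q\<close>. For the four values \<open>15p\<close>, \<open>20p\<close>, \<open>24p\<close>, \<open>60(p - 1)\<close> this forces
  the primes attaining them to be \<open>2\<close>, \<open>3\<close>, \<open>5\<close>, \<open>p\<close> in this order, and then \<open>|G| = 60p\<close>.
  A prime \<open>q\<close> dividing \<open>|G|\<close> exactly once satisfies \<open>q e\<^sub>q = n |C(x)|\<close>, where \<open>x\<close> has order \<open>q\<close> and
  \<open>n \<equiv> -1\<close> modulo \<open>q\<close> is the number of elements of order \<open>q\<close>; with \<open>q = 5\<close> and \<open>q = p\<close> this makes an
  element of order \<open>p\<close> central. The transfer into the central subgroup it generates splits it off,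
  \<open>G \<cong> H \<times> \<int>\<^sub>p\<close> with \<open>|H| = 60\<close>. In \<open>H\<close> the orders are
  \<open>1, 2, 3, 5\<close>, occurring \<open>1, 15, 20, 24\<close> times, so the 15 involutions form five Klein four-groups, on which
  \<open>H\<close> acts faithfully and by even permutations. Hence \<open>H\<close> is the alternating group of degree 5, and
  the same argument applies to \<open>PSL(2,5)\<close>.\<close>

section \<open>Conjugation and centralizers\<close>

text \<open>The set \<open>Exp_rho G\<close> does not say which prime owns which exponent, so the
  values alone must reveal the primes. They arise because PSL(2,5) has 15, 20 and 24 elements of
  orders 2, 3 and 5, each counted p times in the direct product, and because 60(p - 1) elements have
  order divisible by p. Matching values with primes rests on the fact that every other prime divisor
  of |G| divides e_q; this is why a case of Frobenius's theorem is proved. For |G| divisibility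
  leaves 30p and 60p, and 30p is too small to hold e_p = 60(p - 1) elements. The splitting works
  because the index 60 is prime to p: on the central subgroup the transfer is z -> z^60, a
  bijection. Afterwards 15 + 20 + 24 = 59 leaves each nonidentity element of H room for a single
  prime factor. Faithfulness of the action on the five four-groups needs a separate argument for
  elements of order 3, which may rotate the three involutions of a four-group; commutators with
  involutions rule them out.\<close>

lemma funpow_fixed_cong:
  assumes "finite S" "prime q" "\<And>s. s \<in> S \<Longrightarrow> f s \<in> S" "\<And>s. s \<in> S \<Longrightarrow> (f ^^ q) s = s"
  shows "[card S = card {s \<in> S. f s = s}] (mod q)"
  using assms(1,3,4)
proof (induction "card S" arbitrary: S rule: less_induct)
  case less
  have q1: "q > 1" using prime_gt_1_nat[OF assms(2)] .
  show ?case
  proof (cases "\<exists>s\<in>S. f s \<noteq> s")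
    case False
    then have "{s \<in> S. f s = s} = S" by auto
    then show ?thesis by (simp add: cong_def)
  next
    case True
    then obtain s where s: "s \<in> S" "f s \<noteq> s" by blast
    have inS: "(f ^^ i) s \<in> S" for i by (induction i) (use s less.prems in auto)
    have per: "(f ^^ (q * k)) t = t" if "t \<in> S" for k t
      using that less.prems(3) by (induction k) (auto simp: funpow_add)
    \<comment> \<open>By Bezout some multiple of \<open>d\<close> is 1 modulo \<open>q\<close>, so a
      point fixed by \<open>f ^^ d\<close> and by \<open>f ^^ q\<close> is fixed by
      \<open>f\<close>.\<close>
    have nofix: "(f ^^ d) t \<noteq> t" if t: "t \<in> S" "f t \<noteq> t" and d: "\<not> q dvd d" for d t
    proof
      assume fd: "(f ^^ d) t = t"
      have "coprime d q" using d assms(2) by (metis coprime_commute prime_imp_coprime)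
      then obtain u v where "d * u = q * v + 1"
        using bezout_nat[of d q] q1 d
        by (metis coprime_imp_gcd_eq_1 dvd_0_right)
      moreover have "(f ^^ (d * k)) t = t" for k
        using fd by (induction k) (auto simp: funpow_add)
      ultimately have "(f ^^ (q * v + 1)) t = t" by metis
      then have "(f ^^ (1 + q * v)) t = t" by (simp only: add.commute)
      then show False using per[OF t(1), of v] t(2) by (simp add: funpow_add)
    qed
    have fixes_f: "f ((f ^^ i) s) \<noteq> (f ^^ i) s" for i
    proof
      assume a: "f ((f ^^ i) s) = (f ^^ i) s"
      have "(f ^^ j) ((f ^^ i) s) = (f ^^ i) s" for j using a by (induction j) auto
      then have b: "(f ^^ (j + i)) s = (f ^^ i) s" for j by (simp add: funpow_add)
      have "(f ^^ (q * i)) s = (f ^^ i) s" using b[of "q * i - i"] q1 by simp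
      then have "(f ^^ i) s = s" using per[OF s(1)] by simp
      then show False using a s by simp
    qed
    \<comment> \<open>The orbit of a moved point has exactly \<open>q\<close> elements, so removing
      it changes neither the fixed points nor the residue of \<open>card S\<close>.\<close>
    define Ob where "Ob = (\<lambda>i. (f ^^ i) s) ` {..<q}"
    have inj: "inj_on (\<lambda>i. (f ^^ i) s) {..<q}"
    proof (rule linorder_inj_onI')
      fix i j assume ij: "i \<in> {..<q}" "j \<in> {..<q}" "i < j"
      have "(f ^^ (j - i)) ((f ^^ i) s) \<noteq> (f ^^ i) s"
        using nofix[OF inS fixes_f, of "j - i"] ij by (metis diff_is_0_eq' dual_order.strict_iff_not lessThan_iff less_imp_diff_less nat_dvd_not_less zero_less_diff)
      then show "(f ^^ i) s \<noteq> (f ^^ j) s"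
        using ij by (simp flip: funpow_add[THEN fun_cong, unfolded o_def])
    qed
    have cO: "card Ob = q" unfolding Ob_def using card_image[OF inj] by simp
    have OS: "Ob \<subseteq> S" using inS by (auto simp: Ob_def)
    \<comment> \<open>Stability of the complement: \<open>q - 1\<close> further steps lead from
      \<open>f t\<close> back to \<open>t\<close>, so \<open>t\<close> would lie on the orbit as
      well.\<close>
    have "f t \<notin> Ob" if t: "t \<in> S - Ob" for t
    proof
      assume "f t \<in> Ob"
      then obtain i where i: "f t = (f ^^ i) s" by (auto simp: Ob_def)
      have "t = (f ^^ q) t" using less.prems(3) t by simp
      also have "\<dots> = (f ^^ (q - 1)) (f t)"
        using q1 by (metis Suc_diff_1 funpow_Suc_right less_trans o_apply zero_less_one)
      also have "\<dots> = (f ^^ (q - 1 + i)) s" by (simp add: i funpow_add)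
      also have "\<dots> = (f ^^ ((q - 1 + i) mod q + q * ((q - 1 + i) div q))) s" by simp
      also have "\<dots> = (f ^^ ((q - 1 + i) mod q)) s"
        unfolding funpow_add o_apply per[OF s(1)] ..
      also have "\<dots> \<in> Ob" using q1 by (auto simp: Ob_def)
      finally show False using t by simp
    qed
    then have cl: "f t \<in> S - Ob" if "t \<in> S - Ob" for t using that less.prems(2) by blast
    have cS: "card S = card (S - Ob) + q"
      using card_Diff_subset[OF _ OS] cO finite_subset[OF OS] less.prems(1) card_mono[OF less.prems(1) OS] by simp
    have "[card (S - Ob) = card {s \<in> S - Ob. f s = s}] (mod q)"
      by (rule less.hyps) (use cS q1 less.prems cl in auto)
    moreover have "{s \<in> S - Ob. f s = s} = {s \<in> S. f s = s}"
      using fixes_f by (auto simp: Ob_def)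
    ultimately show ?thesis using cS by (simp add: cong_def)
  qed
qed

context group
begin

definition centralizer :: "'a \<Rightarrow> 'a set" where
  "centralizer x = {g \<in> carrier G. g \<otimes> x = x \<otimes> g}"

definition conjugate :: "'a \<Rightarrow> 'a \<Rightarrow> 'a" where
  "conjugate g x = g \<otimes> x \<otimes> inv g"

definition conj_class :: "'a \<Rightarrow> 'a set" where
  "conj_class x = (\<lambda>g. conjugate g x) ` carrier G"

definition prime_power_elements :: "nat \<Rightarrow> 'a set" where
  "prime_power_elements q = {x \<in> carrier G. \<exists>k. ord x = q ^ k}"

definition regular_elements :: "nat \<Rightarrow> 'a set" where
  "regular_elements q = {x \<in> carrier G. \<not> q dvd ord x}"

definition elements_of_order :: "nat \<Rightarrow> 'a set" where
  "elements_of_order q = {x \<in> carrier G. ord x = q}"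

lemma ord_eqI: "x \<in> carrier G \<Longrightarrow> (\<And>n. x [^] n = \<one> \<longleftrightarrow> d dvd n) \<Longrightarrow> ord x = d"
  by (simp add: ord_unique)

lemma ord_subgroup:
  assumes "subgroup H G" "x \<in> H"
  shows "group.ord (G\<lparr>carrier := H\<rparr>) x = ord x"
proof -
  interpret H: group "G\<lparr>carrier := H\<rparr>" using subgroup_imp_group[OF assms(1)] .
  have "x \<in> carrier G" using assms subgroup.mem_carrier by fastforce
  then show ?thesis using assms(2)
    by (intro H.ord_eqI) (simp_all flip: nat_pow_consistent add: pow_eq_id)
qed

lemma centralizer_subgroup:
  assumes x: "x \<in> carrier G" shows "subgroup (centralizer x) G"
proof (rule subgroupI)
  show "centralizer x \<noteq> {}" using x by (auto simp: centralizer_def)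
  show "inv a \<in> centralizer x" if "a \<in> centralizer x" for a
    using that x by (auto simp: centralizer_def) (metis inv_closed inv_solve_left inv_solve_right m_closed m_assoc)
  show "a \<otimes> b \<in> centralizer x" if "a \<in> centralizer x" "b \<in> centralizer x" for a b
    using that x by (auto simp: centralizer_def) (metis m_assoc)
qed (auto simp: centralizer_def)

lemma centralizer_sub: "centralizer x \<subseteq> carrier G" by (auto simp: centralizer_def)

lemma centralizer_self: "x \<in> carrier G \<Longrightarrow> x \<in> centralizer x" by (auto simp: centralizer_def)

lemma centralizer_sym: "x \<in> carrier G \<Longrightarrow> y \<in> centralizer x \<Longrightarrow> x \<in> centralizer y"
  by (auto simp: centralizer_def)

lemma conjugate_closed [simp]: "g \<in> carrier G \<Longrightarrow> x \<in> carrier G \<Longrightarrow> conjugate g x \<in> carrier G"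
  by (simp add: conjugate_def)

lemma conjugate_mult:
  "\<lbrakk>g \<in> carrier G; h \<in> carrier G; x \<in> carrier G\<rbrakk> \<Longrightarrow> conjugate g (conjugate h x) = conjugate (g \<otimes> h) x"
  by (simp add: conjugate_def inv_mult_group m_assoc)

lemma conjugate_one [simp]: "x \<in> carrier G \<Longrightarrow> conjugate \<one> x = x"
  by (simp add: conjugate_def)

lemma conjugate_inv [simp]: "\<lbrakk>g \<in> carrier G; x \<in> carrier G\<rbrakk> \<Longrightarrow> conjugate (inv g) (conjugate g x) = x"
  by (simp add: conjugate_mult)

lemma conjugate_inv' [simp]: "\<lbrakk>g \<in> carrier G; x \<in> carrier G\<rbrakk> \<Longrightarrow> conjugate g (conjugate (inv g) x) = x"
  by (simp add: conjugate_mult)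

lemma conjugate_dist:
  "\<lbrakk>g \<in> carrier G; x \<in> carrier G; y \<in> carrier G\<rbrakk> \<Longrightarrow> conjugate g (x \<otimes> y) = conjugate g x \<otimes> conjugate g y"
  by (simp add: conjugate_def m_assoc inv_solve_left)

lemma conjugate_eq_iff:
  "\<lbrakk>g \<in> carrier G; x \<in> carrier G; y \<in> carrier G\<rbrakk> \<Longrightarrow> conjugate g x = conjugate g y \<longleftrightarrow> x = y"
  by (metis conjugate_inv)

lemma conjugate_fixed_iff:
  "\<lbrakk>g \<in> carrier G; x \<in> carrier G\<rbrakk> \<Longrightarrow> conjugate g x = x \<longleftrightarrow> g \<otimes> x = x \<otimes> g"
  by (metis conjugate_def inv_solve_right' m_closed)

lemma conjugate_pow:
  "\<lbrakk>g \<in> carrier G; x \<in> carrier G\<rbrakk> \<Longrightarrow> conjugate g (x [^] (n::nat)) = conjugate g x [^] n"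
proof (induction n)
  case 0 then show ?case by (simp add: conjugate_def)
qed (simp add: conjugate_dist)

lemma conjugate_eq_one_iff: "\<lbrakk>g \<in> carrier G; x \<in> carrier G\<rbrakk> \<Longrightarrow> conjugate g x = \<one> \<longleftrightarrow> x = \<one>"
  by (metis conjugate_inv conjugate_def inv_closed one_closed r_one r_inv)

lemma ord_conjugate [simp]: "\<lbrakk>g \<in> carrier G; x \<in> carrier G\<rbrakk> \<Longrightarrow> ord (conjugate g x) = ord x"
  by (rule ord_eqI) (simp_all flip: conjugate_pow add: conjugate_eq_one_iff pow_eq_id)

lemma funpow_conjugate:
  "\<lbrakk>g \<in> carrier G; x \<in> carrier G\<rbrakk> \<Longrightarrow> (conjugate g ^^ n) x = conjugate (g [^] n) x"
proof (induction n)
  case (Suc n)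
  then show ?case by (simp add: conjugate_mult) (metis nat_pow_Suc nat_pow_Suc2)
qed simp

lemma centralizer_conjugate:
  assumes "g \<in> carrier G" "x \<in> carrier G"
  shows "centralizer (conjugate g x) = conjugate g ` centralizer x"
proof -
  have 1: "conjugate h ` centralizer y \<subseteq> centralizer (conjugate h y)"
    if "h \<in> carrier G" "y \<in> carrier G" for h y
    using that by (auto simp: centralizer_def simp flip: conjugate_dist)
  have "centralizer (conjugate g x) = conjugate g ` conjugate (inv g) ` centralizer (conjugate g x)"
    using assms by (auto simp: image_image centralizer_def)
  also have "\<dots> \<subseteq> conjugate g ` centralizer x"
    using 1[of "inv g" "conjugate g x"] assms by (intro image_mono) simp
  finally show ?thesis using 1[OF assms] by blast
qed

section \<open>Conjugacy classes, sums of class functions, and Cauchy's theorem\<close>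

lemma card_conj_class:
  assumes "finite (carrier G)" "x \<in> carrier G"
  shows "card (conj_class x) * card (centralizer x) = order G"
proof -
  interpret act: group_action G "carrier G" "\<lambda>g. \<lambda>h \<in> carrier G. g \<otimes> h \<otimes> inv g"
    by (rule action_by_conjugation)
  have "orbit G (\<lambda>g. \<lambda>h \<in> carrier G. g \<otimes> h \<otimes> inv g) x = conj_class x"
    using assms by (auto simp: orbit_def conj_class_def conjugate_def)
  moreover have "stabilizer G (\<lambda>g. \<lambda>h \<in> carrier G. g \<otimes> h \<otimes> inv g) x = centralizer x"
    using assms conjugate_fixed_iff by (auto simp: stabilizer_def centralizer_def conjugate_def)
  ultimately show ?thesis using act.orbit_stabilizer_theorem[OF assms(2)] by simp
qed

lemma conj_class_self: "x \<in> carrier G \<Longrightarrow> x \<in> conj_class x"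
  by (auto simp: conj_class_def intro!: image_eqI[of _ _ \<one>])

text \<open>\<open>S\<close> is a union of conjugacy classes and \<open>h\<close> is constant on
  each, so the sum splits into the products in the last assumption. The class size is kept in that
  assumption because it supplies the factor of \<open>m\<close> that \<open>h s\<close>, a count
  inside a centralizer, cannot.\<close>

lemma sum_class_function_dvd:
  fixes h :: "'a \<Rightarrow> nat"
  assumes "finite (carrier G)" "S \<subseteq> carrier G"
    "\<And>g s. \<lbrakk>g \<in> carrier G; s \<in> S\<rbrakk> \<Longrightarrow> conjugate g s \<in> S"
    "\<And>g s. \<lbrakk>g \<in> carrier G; s \<in> S\<rbrakk> \<Longrightarrow> h (conjugate g s) = h s"
    "\<And>s. s \<in> S \<Longrightarrow> m dvd card (conj_class s) * h s"
  shows "m dvd (\<Sum>s\<in>S. h s)"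
  using assms(2-)
proof (induction "card S" arbitrary: S rule: less_induct)
  case less
  note prems = less.prems
  show ?case
  proof (cases "S = {}")
    case False
    then obtain s where s: "s \<in> S" by blast
    have sG: "s \<in> carrier G" using s prems by blast
    let ?C = "conj_class s"
    have CS: "?C \<subseteq> S" using s prems by (auto simp: conj_class_def)
    have fS: "finite S" using finite_subset[OF prems(1) assms(1)] .
    have "m dvd (\<Sum>s\<in>S - ?C. h s)"
    proof (rule less.hyps)
      show "card (S - ?C) < card S"
        using fS s conj_class_self[OF sG] by (intro psubset_card_mono) auto
      show "conjugate g t \<in> S - ?C" if g: "g \<in> carrier G" and t: "t \<in> S - ?C" for g t
      proof -
        have tG: "t \<in> carrier G" using t prems by blast
        have "conjugate g t \<notin> ?C"
        proof
          assume "conjugate g t \<in> ?C"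
          then obtain k where k: "k \<in> carrier G" "conjugate g t = conjugate k s" by (auto simp: conj_class_def)
          then have "t = conjugate (inv g \<otimes> k) s"
            using g tG sG by (metis conjugate_inv conjugate_mult inv_closed)
          then show False using t g k by (auto simp: conj_class_def)
        qed
        then show ?thesis using prems g t by blast
      qed
    qed (use prems in auto)
    moreover have "(\<Sum>t\<in>?C. h t) = (\<Sum>t\<in>?C. h s)"
      by (rule sum.cong) (use prems(3) s in \<open>auto simp: conj_class_def\<close>)
    ultimately show ?thesis using sum.subset_diff[OF CS fS, of h] prems(4)[OF s] by simp
  qed simp
qed

text \<open>Conjugation by \<open>x\<close> is a map of period \<open>q\<close> on \<open>S\<close>
  whose fixed points are the elements commuting with \<open>x\<close>.\<close>

lemma conjugation_fixed_cong:
  assumes "prime q" "x \<in> carrier G" "x [^] q = \<one>" "finite S" "S \<subseteq> carrier G"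
    "\<And>s. s \<in> S \<Longrightarrow> conjugate x s \<in> S"
  shows "[card S = card (S \<inter> centralizer x)] (mod q)"
proof -
  have "[card S = card {s \<in> S. conjugate x s = s}] (mod q)"
    by (rule funpow_fixed_cong) (use assms in \<open>auto simp: funpow_conjugate\<close>)
  moreover have "{s \<in> S. conjugate x s = s} = S \<inter> centralizer x"
    using assms conjugate_fixed_iff by (auto simp: centralizer_def)
  ultimately show ?thesis by simp
qed

lemma cauchy:
  assumes "finite (carrier G)" "prime q" "q dvd order G"
  shows "\<exists>x \<in> carrier G. ord x = q"
proof -
  obtain H where H: "subgroup H G" "card H = q"
    using sylow_thm[OF assms(2) is_group, of 1 "order G div q"] assms by auto
  then obtain x where x: "x \<in> H" "x \<noteq> \<one>"
    using prime_gt_1_nat[OF assms(2)] by (metis card_1_singleton_iff card_eq_0_iff insertI1 less_not_refl not_less_zero subsetI subset_singleton_iff card.empty card_mono finite.intros(1) finite_insert is_singletonI is_singleton_altdef One_nat_def)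
  interpret H: group "G\<lparr>carrier := H\<rparr>" using subgroup_imp_group[OF H(1)] .
  have xG: "x \<in> carrier G" using x H subgroup.mem_carrier by fastforce
  have "ord x dvd q" using H.ord_dvd_group_order[of x] x ord_subgroup[OF H(1) x(1)] H by (simp add: order_def)
  then show ?thesis using assms(2) x ord_eq_1[OF xG] xG by (auto simp: prime_nat_iff)
qed

end

section \<open>Counting elements of order prime to q\<close>

context group
begin

section \<open>Splitting an element into its q-part and its q'-part\<close>

lemma pow_cong:
  assumes "x \<in> carrier G" "[i = j] (mod n)" "ord x dvd n"
  shows "x [^] (i::nat) = x [^] j"
proof -
  have "[int j = int i] (mod int (ord x))"
    using cong_dvd_modulus_nat[OF assms(2,3)] by (simp add: cong_int_iff cong_sym)
  then show ?thesis
    using int_pow_eq[OF assms(1), of "int i" "int j"] by (simp add: int_pow_int cong_iff_dvd_diff)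
qed

lemma ord_mult_coprime:
  assumes "x \<in> carrier G" "y \<in> carrier G" "x \<otimes> y = y \<otimes> x" "coprime (ord x) (ord y)"
  shows "ord (x \<otimes> y) = ord x * ord y"
proof (rule ord_eqI)
  show "(x \<otimes> y) [^] n = \<one> \<longleftrightarrow> ord x * ord y dvd n" for n
  proof
    assume "(x \<otimes> y) [^] n = \<one>"
    then have *: "x [^] (n * k) \<otimes> y [^] (n * k) = \<one>" for k
      using assms by (metis m_closed nat_pow_one nat_pow_pow pow_mult_distrib)
    have 1: "y [^] (n * ord y) = \<one>" and 2: "x [^] (n * ord x) = \<one>"
      using assms by (simp_all add: pow_eq_id)
    have "ord x dvd n * ord y" using *[of "ord y"] assms 1 by (simp add: pow_eq_id)
    moreover have "ord y dvd n * ord x" using *[of "ord x"] assms 2 by (simp add: pow_eq_id)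
    ultimately have "ord x dvd n" "ord y dvd n"
      using assms(4) by (simp_all add: coprime_dvd_mult_left_iff coprime_commute)
    then show "ord x * ord y dvd n" using assms(4) by (simp add: divides_mult)
  next
    assume "ord x * ord y dvd n"
    then have "x [^] n = \<one>" "y [^] n = \<one>" using assms by (auto simp: pow_eq_id dest: dvd_mult_left dvd_mult_right)
    then show "(x \<otimes> y) [^] n = \<one>" using assms by (simp add: pow_mult_distrib)
  qed
qed (use assms in auto)

lemma centralizer_power: "\<lbrakk>x \<in> carrier G; y \<in> centralizer x\<rbrakk> \<Longrightarrow> y \<in> centralizer (x [^] (n::nat))"
  using subgroup.subset[OF centralizer_subgroup, of y]
  by (induction n) (auto simp: centralizer_def m_assoc, metis m_assoc nat_pow_closed)

lemma ord_prime_power_part: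
  assumes "order G = q ^ a * m" "\<not> q dvd m" "prime q" "x \<in> prime_power_elements q"
  shows "ord x dvd q ^ a"
proof -
  obtain k where k: "ord x = q ^ k" and x: "x \<in> carrier G" using assms by (auto simp: prime_power_elements_def)
  have "coprime (q ^ k) m" using assms(2,3) by (simp add: prime_imp_coprime)
  then show ?thesis using ord_dvd_group_order[OF x] assms k by (simp add: coprime_dvd_mult_left_iff)
qed

lemma ord_regular_part:
  assumes "order G = q ^ a * m" "prime q" "y \<in> regular_elements q"
  shows "ord y dvd m"
proof -
  have y: "y \<in> carrier G" "\<not> q dvd ord y" using assms by (auto simp: regular_elements_def)
  then have "coprime (ord y) (q ^ a)" using assms(2) by (simp add: prime_imp_coprime coprime_commute)
  then show ?thesis using ord_dvd_group_order[OF y(1)] assms by (simp add: coprime_dvd_mult_right_iff)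
qed

text \<open>The Chinese remainder theorem provides exponents \<open>u\<close> (1 modulo the q-part
  of |G|, 0 modulo the rest) and \<open>v\<close> (the reverse). Then g is the product of
  \<open>g [^] u\<close> and \<open>g [^] v\<close>, and the \<open>u\<close>-th power of any such
  product returns its first factor, which gives uniqueness.\<close>

lemma bij_prime_power_regular:
  assumes fin: "finite (carrier G)" and q: "prime q"
  shows "bij_betw (\<lambda>(x, y). x \<otimes> y)
    (SIGMA x:prime_power_elements q. centralizer x \<inter> regular_elements q) (carrier G)"
proof -
  have "order G \<noteq> 0" using fin order_gt_0_iff_finite by simp
  then obtain m where om: "order G = q ^ multiplicity q (order G) * m" and m: "\<not> q dvd m"
    using multiplicity_decompose' q not_prime_unit by metis
  define a where "a = multiplicity q (order G)"
  note om = om[folded a_def]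
  have cop: "coprime (q ^ a) m" using q m by (simp add: prime_imp_coprime)
  obtain u where u: "[u = 1] (mod q ^ a)" "[u = 0] (mod m)"
    using binary_chinese_remainder_nat[OF cop] by blast
  obtain v where v: "[v = 0] (mod q ^ a)" "[v = 1] (mod m)"
    using binary_chinese_remainder_nat[OF cop] by blast
  note ox = ord_prime_power_part[OF om m q] and oy = ord_regular_part[OF om q]
  show ?thesis unfolding bij_betw_def
  proof
    have part: "(x \<otimes> y) [^] u = x"
      if "x \<in> prime_power_elements q" "y \<in> centralizer x \<inter> regular_elements q" for x y
    proof -
      have xy: "x \<in> carrier G" "y \<in> carrier G" "x \<otimes> y = y \<otimes> x"
        using that by (auto simp: prime_power_elements_def centralizer_def)
      have "x [^] u = x [^] (1::nat)" using pow_cong[OF xy(1) u(1) ox[OF that(1)]] .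
      moreover have "y [^] u = y [^] (0::nat)" using pow_cong[OF xy(2) u(2) oy] that by simp
      ultimately show ?thesis using xy by (simp add: pow_mult_distrib)
    qed
    have closed: "x \<in> carrier G" if "x \<in> prime_power_elements q \<or> x \<in> regular_elements q" for x
      using that by (auto simp: prime_power_elements_def regular_elements_def)
    show "inj_on (\<lambda>(x, y). x \<otimes> y) (SIGMA x:prime_power_elements q. centralizer x \<inter> regular_elements q)"
    proof (rule inj_onI, clarify)
      fix x y x' y'
      assume a: "x \<in> prime_power_elements q" "y \<in> centralizer x" "y \<in> regular_elements q"
        "x' \<in> prime_power_elements q" "y' \<in> centralizer x'" "y' \<in> regular_elements q"
        and eq: "x \<otimes> y = x' \<otimes> y'"
      have "x = x'" using part[of x y] part[of x' y'] a eq by simp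
      then show "x = x' \<and> y = y'" using eq a closed by auto
    qed
    show "(\<lambda>(x, y). x \<otimes> y) ` (SIGMA x:prime_power_elements q. centralizer x \<inter> regular_elements q) = carrier G"
    proof (intro equalityI subsetI)
      fix g assume g: "g \<in> carrier G"
      have og: "ord g dvd q ^ a * m" using ord_dvd_group_order[OF g] om by simp
      have "[u + v = 1 + 0] (mod q ^ a)" "[u + v = 0 + 1] (mod m)"
        using u v by (blast intro: cong_add)+
      then have "[u + v = 1] (mod q ^ a * m)" using cop by (simp add: coprime_cong_mult_nat)
      from pow_cong[OF g this og] have eq: "g = g [^] u \<otimes> g [^] v" using g by (simp add: nat_pow_mult)
      have "(g [^] u) [^] (q ^ a) = \<one>" "(g [^] v) [^] m = \<one>"
        using g og u v by (auto simp: nat_pow_pow pow_eq_id cong_0_iff mult.commute intro: dvd_trans[OF _ mult_dvd_mono])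
      then have "ord (g [^] u) dvd q ^ a" and 2: "ord (g [^] v) dvd m"
        using g by (auto simp: pow_eq_id)
      then have "g [^] u \<in> prime_power_elements q" using g q
        by (auto simp: prime_power_elements_def divides_primepow_nat)
      moreover have "g [^] v \<in> regular_elements q" using g 2 m by (auto simp: regular_elements_def dest: dvd_trans)
      moreover have "g [^] v \<in> centralizer (g [^] u)" using g by (simp add: centralizer_def nat_pow_mult add.commute)
      ultimately show "g \<in> (\<lambda>(x, y). x \<otimes> y) ` (SIGMA x:prime_power_elements q. centralizer x \<inter> regular_elements q)"
        using eq by (intro image_eqI[of _ _ "(g [^] u, g [^] v)"]) auto
    qed (use closed in auto)
  qed
qed

lemma finite_prime_power_elements: "finite (carrier G) \<Longrightarrow> finite (prime_power_elements q)"
  by (auto simp: prime_power_elements_def)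

lemma finite_regular_elements: "finite (carrier G) \<Longrightarrow> finite (regular_elements q)"
  by (auto simp: regular_elements_def)

lemma sum_prime_power_regular:
  fixes f :: "'a \<Rightarrow> nat"
  assumes fin: "finite (carrier G)" and q: "prime q"
  shows "(\<Sum>g\<in>carrier G. f g) =
    (\<Sum>x\<in>prime_power_elements q. \<Sum>y\<in>centralizer x \<inter> regular_elements q. f (x \<otimes> y))"
  unfolding sum.reindex_bij_betw[OF bij_prime_power_regular[OF assms], of f, symmetric]
  using fin finite_prime_power_elements finite_regular_elements
  by (subst sum.Sigma) (auto simp: split_def)

lemma order_eq_sum_regular:
  assumes fin: "finite (carrier G)" and q: "prime q"
  shows "order G = (\<Sum>x\<in>prime_power_elements q. card (centralizer x \<inter> regular_elements q))"
  using sum_prime_power_regular[OF assms, of "\<lambda>_. 1"] by (simp add: order_def)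

lemma regular_elements_subgroup:
  "subgroup H G \<Longrightarrow> group.regular_elements (G\<lparr>carrier := H\<rparr>) q = H \<inter> regular_elements q"
  using group.regular_elements_def[OF subgroup_imp_group, of H] subgroup.subset[of H G]
  by (auto simp: regular_elements_def ord_subgroup)

lemma prime_power_elements_subgroup:
  "subgroup H G \<Longrightarrow> group.prime_power_elements (G\<lparr>carrier := H\<rparr>) q = H \<inter> prime_power_elements q"
  using group.prime_power_elements_def[OF subgroup_imp_group, of H] subgroup.subset[of H G]
  by (auto simp: prime_power_elements_def ord_subgroup)

lemma elements_of_order_subgroup:
  "subgroup H G \<Longrightarrow> group.elements_of_order (G\<lparr>carrier := H\<rparr>) q = H \<inter> elements_of_order q"
  using group.elements_of_order_def[OF subgroup_imp_group, of H] subgroup.subset[of H G]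
  by (auto simp: elements_of_order_def ord_subgroup)

lemma centralizer_in_subgroup:
  "subgroup H G \<Longrightarrow> group.centralizer (G\<lparr>carrier := H\<rparr>) x = H \<inter> centralizer x"
  using group.centralizer_def[OF subgroup_imp_group, of H] subgroup.subset[of H G]
  by (auto simp: centralizer_def)

lemma card_centralizer_conjugate:
  assumes "g \<in> carrier G" "x \<in> carrier G"
  shows "card (centralizer (conjugate g x)) = card (centralizer x)"
proof -
  have "inj_on (conjugate g) (centralizer x)"
    using assms by (auto simp: inj_on_def centralizer_def conjugate_eq_iff)
  then show ?thesis using centralizer_conjugate[OF assms] by (simp add: card_image)
qed

lemma card_centralizer_regular_conjugate:
  assumes "g \<in> carrier G" "x \<in> carrier G"
  shows "card (centralizer (conjugate g x) \<inter> regular_elements q) = card (centralizer x \<inter> regular_elements q)"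
proof -
  have "centralizer (conjugate g x) \<inter> regular_elements q = conjugate g ` (centralizer x \<inter> regular_elements q)"
    unfolding centralizer_conjugate[OF assms] using assms by (auto simp: regular_elements_def centralizer_def)
  moreover have "inj_on (conjugate g) (centralizer x \<inter> regular_elements q)"
    using assms by (auto simp: inj_on_def centralizer_def conjugate_eq_iff)
  ultimately show ?thesis by (simp add: card_image)
qed

text \<open>Comparing q'-parts in |class of x| |C(x)| = |G| shows that \<open>m\<close> divides the
  class size times the q'-part \<open>l\<close> of |C(x)|. Divisibility claims for G thereby reduce
  to claims for centralizers.\<close>

lemma dvd_card_conj_class_mult:
  assumes "finite (carrier G)" "prime q" "order G = q ^ a * m" "\<not> q dvd m" "x \<in> carrier G"
    "\<And>b l. card (centralizer x) = q ^ b * l \<Longrightarrow> \<not> q dvd l \<Longrightarrow> l dvd k"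
  shows "m dvd card (conj_class x) * k"
proof -
  have "card (centralizer x) \<noteq> 0"
    using centralizer_self[OF assms(5)] finite_subset[OF centralizer_sub assms(1)] by auto
  then obtain l where l: "card (centralizer x) = q ^ multiplicity q (card (centralizer x)) * l" "\<not> q dvd l"
    using multiplicity_decompose' assms(2) not_prime_unit by metis
  then have "l dvd k" using assms(6) by blast
  define b where "b = multiplicity q (card (centralizer x))"
  have "q ^ b * (card (conj_class x) * l) = q ^ a * m"
    using card_conj_class[OF assms(1,5)] l assms(3) unfolding b_def by (metis mult.left_commute)
  then have "m dvd q ^ b * (card (conj_class x) * l)" by simp
  moreover have "coprime m (q ^ b)"
    using prime_imp_coprime[OF assms(2,4)] by (simp add: coprime_commute)
  ultimately have "m dvd card (conj_class x) * l" by (simp add: coprime_dvd_mult_right_iff)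
  then show ?thesis using \<open>l dvd k\<close> by (meson dvd_refl dvd_trans mult_dvd_mono)
qed

text \<open>The point of having a subgroup is that Cauchy's theorem applies to it: its order has no
  prime factor besides \<open>q\<close>, so it can be cancelled against the q'-part of |G|.\<close>

lemma central_prime_power_subgroup:
  assumes "prime q"
  shows "subgroup {x \<in> prime_power_elements q. centralizer x = carrier G} G" (is "subgroup ?Z G")
proof (rule subgroupI)
  have "\<exists>k. ord \<one> = q ^ k" by (rule exI[of _ 0]) simp
  then have "\<one> \<in> ?Z" unfolding prime_power_elements_def centralizer_def by auto
  then show "?Z \<noteq> {}" by blast
  show "inv x \<in> ?Z" if "x \<in> ?Z" for x
  proof -
    have x: "x \<in> carrier G" using that by (auto simp: prime_power_elements_def)
    have "g \<otimes> inv x = inv x \<otimes> g" if g: "g \<in> carrier G" for g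
    proof -
      have "x \<in> centralizer g" using g x \<open>x \<in> ?Z\<close> by (auto intro: centralizer_sym)
      then have "inv x \<in> centralizer g" using subgroup.m_inv_closed[OF centralizer_subgroup[OF g]] by blast
      then show ?thesis by (simp add: centralizer_def)
    qed
    then show ?thesis using that x by (auto simp: prime_power_elements_def centralizer_def)
  qed
  show "x \<otimes> y \<in> ?Z" if xy: "x \<in> ?Z" "y \<in> ?Z" for x y
  proof -
    have G: "x \<in> carrier G" "y \<in> carrier G" using xy by (auto simp: prime_power_elements_def)
    have cx: "g \<otimes> x = x \<otimes> g" "g \<otimes> y = y \<otimes> g" if "g \<in> carrier G" for g
      using xy that unfolding centralizer_def by blast+
    have "g \<otimes> (x \<otimes> y) = (x \<otimes> y) \<otimes> g" if "g \<in> carrier G" for g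
      using cx[OF that] G that by (metis m_assoc)
    then have "centralizer (x \<otimes> y) = carrier G" by (auto simp: centralizer_def)
    moreover obtain i j where "ord x = q ^ i" "ord y = q ^ j" using xy by (auto simp: prime_power_elements_def)
    then have "ord (x \<otimes> y) dvd q ^ (i + j)" using ord_mul_divides[OF _ G] cx(2) G by (simp add: power_add)
    ultimately show ?thesis using assms G by (auto simp: prime_power_elements_def divides_primepow_nat)
  qed
qed (auto simp: prime_power_elements_def)

end

text \<open>A special case of Frobenius's theorem on the number of solutions of \<open>x\<^sup>m = 1\<close>. In the count
  \<open>|G| = \<Sum>\<^sub>x #(q'-elements of C(x))\<close> over the \<open>q\<close>-elements \<open>x\<close>, a conjugacy class of non-central
  elements contributes a multiple of \<open>m\<close> by induction, and each central one contributes the wanted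
  number; there are \<open>q\<^sup>k\<close> of the latter.\<close>

lemma dvd_card_regular_elements:
  fixes G :: "('a, 'b) monoid_scheme"
  assumes "group G" "finite (carrier G)" "prime q" "order G = q ^ a * m" "\<not> q dvd m"
  shows "m dvd card (group.regular_elements G q)"
  using assms
proof (induction "order G" arbitrary: G a m rule: less_induct)
  case less
  interpret group G by fact
  note fin = less.prems(2) and q = less.prems(3) and om = less.prems(4) and m = less.prems(5)
  define Z where "Z = {x \<in> prime_power_elements q. centralizer x = carrier G}"
  let ?h = "\<lambda>x. card (centralizer x \<inter> regular_elements q)"
  let ?S = "prime_power_elements q - Z"
  have SG: "?S \<subseteq> carrier G" by (auto simp: prime_power_elements_def)
  have Zsub: "subgroup Z G" unfolding Z_def using central_prime_power_subgroup[OF q] .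
  have "m dvd (\<Sum>x\<in>?S. ?h x)"
  proof (rule sum_class_function_dvd[OF fin SG])
    fix x assume x: "x \<in> ?S"
    then have xG: "x \<in> carrier G" using SG by blast
    have sub: "subgroup (centralizer x) G" using centralizer_subgroup[OF xG] .
    have "centralizer x \<subset> carrier G" using x centralizer_sub by (auto simp: Z_def)
    then have lt: "card (centralizer x) < order G" using fin by (simp add: order_def psubset_card_mono)
    show "m dvd card (conj_class x) * ?h x"
    proof (rule dvd_card_conj_class_mult[OF fin q om m xG])
      fix b l assume bl: "card (centralizer x) = q ^ b * l" "\<not> q dvd l"
      have "l dvd card (group.regular_elements (G\<lparr>carrier := centralizer x\<rparr>) q)"
      proof (rule less.hyps)
        show "order (G\<lparr>carrier := centralizer x\<rparr>) < order G" using lt by (simp add: order_def)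
        show "group (G\<lparr>carrier := centralizer x\<rparr>)" using subgroup_imp_group[OF sub] .
      qed (use bl q fin finite_subset[OF centralizer_sub] in \<open>auto simp: order_def\<close>)
      then show "l dvd ?h x" by (simp add: regular_elements_subgroup[OF sub])
    qed
  next
    fix g x assume gx: "g \<in> carrier G" "x \<in> ?S"
    then have xG: "x \<in> carrier G" using SG by blast
    show "?h (conjugate g x) = ?h x" using card_centralizer_regular_conjugate[OF gx(1) xG] .
    have "centralizer x = conjugate (inv\<^bsub>G\<^esub> g) ` centralizer (conjugate g x)"
      using gx xG centralizer_conjugate[OF inv_closed[OF gx(1)] conjugate_closed[OF gx(1) xG]] by simp
    have "centralizer x = carrier G" if "centralizer (conjugate g x) = carrier G"
    proof -
      have "y \<in> centralizer x" if y: "y \<in> carrier G" for y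
      proof -
        have "conjugate g y \<in> centralizer (conjugate g x)" using \<open>centralizer (conjugate g x) = carrier G\<close> y gx by simp
        then have "y \<in> conjugate (inv\<^bsub>G\<^esub> g) ` centralizer (conjugate g x)" using y gx by (auto intro!: image_eqI[of _ _ "conjugate g y"])
        then show ?thesis using \<open>centralizer x = conjugate (inv\<^bsub>G\<^esub> g) ` centralizer (conjugate g x)\<close> by simp
      qed
      then show ?thesis using centralizer_sub by blast
    qed
    then show "conjugate g x \<in> ?S" using gx xG by (auto simp: Z_def prime_power_elements_def)
  qed
  moreover have "order G = (\<Sum>x\<in>?S. ?h x) + (\<Sum>x\<in>Z. ?h x)"
    unfolding order_eq_sum_regular[OF fin q]
    by (rule sum.subset_diff) (use fin finite_prime_power_elements in \<open>auto simp: Z_def\<close>)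
  moreover have "(\<Sum>x\<in>Z. ?h x) = card Z * card (regular_elements q)"
  proof -
    have "?h x = card (regular_elements q)" if "x \<in> Z" for x
      using that by (auto simp: Z_def regular_elements_def intro: arg_cong[of _ _ card])
    then show ?thesis by simp
  qed
  ultimately have "m dvd card Z * card (regular_elements q)" 
    using om by (metis dvd_add_right_iff dvd_triv_right)
  \<comment> \<open>A common prime \<open>r\<close> would be the order of an element of
    \<open>Z\<close>, hence a power of \<open>q\<close>, hence \<open>q\<close> itself, which does
    not divide \<open>m\<close>.\<close>
  moreover have "coprime m (card Z)"
  proof (rule ccontr)
    assume "\<not> coprime m (card Z)"
    then have "gcd m (card Z) \<noteq> 1" by (simp add: coprime_iff_gcd_eq_1)
    then obtain r where "prime r" "r dvd gcd m (card Z)" using prime_factor_nat by blast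
    then have r: "prime r" "r dvd m" "r dvd card Z" by simp_all
    interpret Z: group "G\<lparr>carrier := Z\<rparr>" using subgroup_imp_group[OF Zsub] .
    have "Z \<subseteq> carrier G" using Zsub subgroup.subset by blast
    then obtain x where x: "x \<in> Z" "ord x = r"
      using Z.cauchy[OF _ r(1)] r fin finite_subset ord_subgroup[OF Zsub] by (auto simp: order_def)
    then obtain k where "r = q ^ k" by (auto simp: Z_def prime_power_elements_def)
    then have "r = q" using r q by (metis prime_dvd_power primes_dvd_imp_eq dvd_refl)
    then show False using r m by simp
  qed
  ultimately show ?case by (simp add: coprime_dvd_mult_right_iff)
qed

context group
begin

text \<open>If \<open>x\<close> is the q-part and \<open>y\<close> the q'-part of an element, its
  order is \<open>ord x * ord y\<close>, and only the first factor involves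
  \<open>q\<close>.\<close>

lemma sum_multiplicity_ord:
  assumes fin: "finite (carrier G)" and q: "prime q"
  shows "(\<Sum>g\<in>carrier G. multiplicity q (ord g)) = 
    (\<Sum>x\<in>prime_power_elements q. multiplicity q (ord x) * card (centralizer x \<inter> regular_elements q))"
proof -
  have "(\<Sum>g\<in>carrier G. multiplicity q (ord g)) =
    (\<Sum>x\<in>prime_power_elements q. \<Sum>y\<in>centralizer x \<inter> regular_elements q. multiplicity q (ord (x \<otimes> y)))"
    by (rule sum_prime_power_regular[OF fin q])
  also have "\<dots> = (\<Sum>x\<in>prime_power_elements q. \<Sum>y\<in>centralizer x \<inter> regular_elements q. multiplicity q (ord x))"
  proof (intro sum.cong refl)
    fix x y assume xy: "x \<in> prime_power_elements q" "y \<in> centralizer x \<inter> regular_elements q"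
    then obtain k where x: "x \<in> carrier G" "ord x = q ^ k" by (auto simp: prime_power_elements_def)
    have y: "y \<in> carrier G" "\<not> q dvd ord y" "x \<otimes> y = y \<otimes> x" using xy by (auto simp: regular_elements_def centralizer_def)
    have "coprime (ord x) (ord y)" using x y q by (simp add: prime_imp_coprime)
    then have "ord (x \<otimes> y) = ord x * ord y" using x y ord_mult_coprime by blast
    moreover have "ord x \<noteq> 0" "ord y \<noteq> 0" using ord_ge_1[OF fin x(1)] ord_ge_1[OF fin y(1)] by linarith+
    ultimately show "multiplicity q (ord (x \<otimes> y)) = multiplicity q (ord x)"
      using q y by (simp add: prime_elem_multiplicity_mult_distrib not_dvd_imp_multiplicity_0)
  qed
  also have "\<dots> = (\<Sum>x\<in>prime_power_elements q. multiplicity q (ord x) * card (centralizer x \<inter> regular_elements q))" by (simp add: mult.commute)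
  finally show ?thesis .
qed

text \<open>The Frobenius count inside C(x) makes the weight of each q-element \<open>x\<close>
  divisible by the q'-part of |C(x)|, and the size of the class of \<open>x\<close> supplies the
  rest of \<open>m\<close>.\<close>

lemma dvd_sum_multiplicity_ord:
  assumes fin: "finite (carrier G)" and q: "prime q" and om: "order G = q ^ a * m" and m: "\<not> q dvd m"
  shows "m dvd (\<Sum>g\<in>carrier G. multiplicity q (ord g))"
  unfolding sum_multiplicity_ord[OF fin q]
proof (rule sum_class_function_dvd[OF fin])
  let ?h = "\<lambda>x. card (centralizer x \<inter> regular_elements q)"
    fix x assume "x \<in> prime_power_elements q"
    then have x: "x \<in> carrier G" by (auto simp: prime_power_elements_def)
    have "m dvd card (conj_class x) * ?h x"
    proof (rule dvd_card_conj_class_mult[OF fin q om m x])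
      fix b l assume "card (centralizer x) = q ^ b * l" "\<not> q dvd l"
      then have "l dvd card (group.regular_elements (G\<lparr>carrier := centralizer x\<rparr>) q)"
        using subgroup_imp_group[OF centralizer_subgroup[OF x]] finite_subset[OF centralizer_sub fin] q
        by (intro dvd_card_regular_elements) (auto simp: order_def)
      then show "l dvd ?h x" by (simp add: regular_elements_subgroup[OF centralizer_subgroup[OF x]])
    qed
    then show "m dvd card (conj_class x) * (multiplicity q (ord x) * ?h x)"
      by (metis dvd_mult mult.left_commute)
qed (auto simp: prime_power_elements_def card_centralizer_regular_conjugate)


end

section \<open>Primes dividing the group order exactly once\<close>

context group
begin

definition powers :: "'a \<Rightarrow> 'a set" where
  "powers x = range (\<lambda>n::nat. x [^] n)"

lemma powers_subgroup:
  assumes "finite (carrier G)" "x \<in> carrier G" shows "subgroup (powers x) G"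
  using element_generates_subgroup[OF assms] ord_elems[OF assms] by (simp add: powers_def full_SetCompr_eq)

lemma card_powers:
  assumes "finite (carrier G)" "x \<in> carrier G" shows "card (powers x) = ord x"
proof -
  have "powers x = (\<lambda>n. x [^] n) ` {0 .. ord x - 1}"
    using ord_elems[OF assms] unfolding powers_def by (simp only: Setcompr_eq_image)
  then show ?thesis using card_image[OF ord_inj[OF assms(2)]] ord_ge_1[OF assms] by simp
qed

lemma one_in_powers: "\<one> \<in> powers x"
  by (auto simp: powers_def intro: image_eqI[of _ _ "0::nat"])

lemma powers_centralizer: "\<lbrakk>x \<in> carrier G; y \<in> powers x\<rbrakk> \<Longrightarrow> centralizer x \<subseteq> centralizer y"
  using centralizer_power by (auto simp: powers_def)

text \<open>\<open>powers x\<close> is central in C(x), and the order \<open>k\<close> of the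
  quotient is prime to \<open>q\<close> because \<open>q ^ 2\<close> does not divide |G|. So
  \<open>z [^] k\<close> lies in \<open>powers x\<close>, and \<open>z\<close> is a power of
  \<open>z [^] k\<close> since \<open>k\<close> is invertible modulo \<open>q\<close>.\<close>

lemma mem_powers_of_commuting:
  assumes fin: "finite (carrier G)" and q: "prime q" and nq: "\<not> q ^ 2 dvd order G"
    and x: "x \<in> carrier G" "ord x = q" and z: "z \<in> centralizer x" "ord z = q"
  shows "z \<in> powers x"
proof -
  let ?C = "G\<lparr>carrier := centralizer x\<rparr>"
  note sub = centralizer_subgroup[OF x(1)]
  interpret C: group ?C using subgroup_imp_group[OF sub] .
  have zG: "z \<in> carrier G" using z centralizer_sub by blast
  have NC: "powers x \<subseteq> centralizer x"
    using x(1) by (auto simp: powers_def centralizer_def) (metis nat_pow_comm nat_pow_eone)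
  have Nsub: "subgroup (powers x) ?C"
    using subgroup_incl[OF powers_subgroup[OF fin x(1)] sub NC] .
  have "powers x \<lhd> ?C" unfolding C.normal_inv_iff
  proof (intro conjI Nsub ballI)
    fix g h assume g: "g \<in> carrier ?C" and h: "h \<in> powers x"
    have hC: "h \<in> carrier ?C" using h NC by auto
    have "g \<otimes>\<^bsub>?C\<^esub> h = h \<otimes>\<^bsub>?C\<^esub> g"
      using powers_centralizer[OF x(1) h] g by (auto simp: centralizer_def)
    then have "g \<otimes>\<^bsub>?C\<^esub> h \<otimes>\<^bsub>?C\<^esub> inv\<^bsub>?C\<^esub> g = h"
      using C.inv_solve_right'[OF hC C.m_closed[OF g hC] g] by simp
    then show "g \<otimes>\<^bsub>?C\<^esub> h \<otimes>\<^bsub>?C\<^esub> inv\<^bsub>?C\<^esub> g \<in> powers x" using h by simp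
  qed
  then interpret N: normal "powers x" ?C .
  interpret Q: group "?C Mod powers x" using N.factorgroup_is_group .
  define k where "k = order (?C Mod powers x)"
  have kq: "k * q = card (centralizer x)"
    using C.lagrange[OF Nsub] card_powers[OF fin x(1)] x(2) by (simp add: k_def order_def FactGroup_def)
  have "card (centralizer x) dvd order G"
    using card_conj_class[OF fin x(1)] by (metis dvd_triv_right)
  then have nqk: "\<not> q dvd k" using nq kq q
    by (metis dvd_trans mult_dvd_mono dvd_refl power2_eq_square)
  have "r_coset ?C (powers x) z \<in> carrier (?C Mod powers x)" using z by (auto simp: carrier_FactGroup)
  then have "r_coset ?C (powers x) (z [^]\<^bsub>?C\<^esub> k) = powers x"
    using Q.pow_order_eq_1 N.FactGroup_pow[of z k] z by (simp add: k_def)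
  then have "z [^]\<^bsub>?C\<^esub> k \<in> powers x"
    using C.rcos_self[OF C.nat_pow_closed Nsub, of z k] z by simp
  then obtain n where n: "z [^] k = x [^] (n::nat)" by (auto simp: powers_def simp flip: nat_pow_consistent)
  obtain u v where uv: "k * u = q * v + 1"
    using bezout_nat[of k q] prime_imp_coprime[OF q nqk] nqk
    by (metis coprime_commute coprime_imp_gcd_eq_1 dvd_0_right)
  have "z = z [^] (q * v + 1)"
    using zG z pow_eq_id[OF zG, of "q * v"] by simp
  also have "\<dots> = x [^] (n * u)" using n zG x by (metis nat_pow_pow uv)
  finally show ?thesis by (auto simp: powers_def)
qed

end

text \<open>Here the Sylow q-subgroups are the groups \<open>powers x\<close> with \<open>x\<close>
  of order \<open>q\<close>. Counting elements of order \<open>q\<close> in place of subgroups keeps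
  everything in terms of conjugation and centralizers.\<close>

locale sylow_prime = group G for G (structure) +
  fixes q :: nat
  assumes fin: "finite (carrier G)" and prime_q: "prime q"
    and q_dvd: "q dvd order G" and not_sq_dvd: "\<not> q ^ 2 dvd order G"
begin

abbreviation X where "X \<equiv> elements_of_order q"

lemma XD: "x \<in> X \<Longrightarrow> x \<in> carrier G" "x \<in> X \<Longrightarrow> ord x = q"
  by (auto simp: elements_of_order_def)

lemma X_nonempty: "\<exists>x. x \<in> X"
  using cauchy[OF fin prime_q q_dvd] by (auto simp: elements_of_order_def)

lemma finite_X: "finite X" using fin by (auto simp: elements_of_order_def)

lemma powers_minus_one:
  assumes x: "x \<in> X" and y: "y \<in> powers x" "y \<noteq> \<one>"
  shows "y \<in> X"
proof -
  have yG: "y \<in> carrier G" using y XD[OF x] by (auto simp: powers_def)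
  have "ord y dvd q"
  proof -
    obtain n where "y = x [^] (n::nat)" using y by (auto simp: powers_def)
    then have "y [^] q = x [^] (q * n)" using XD[OF x] by (simp add: nat_pow_pow mult.commute)
    then have "y [^] q = \<one>" using XD[OF x] by (metis dvd_triv_left pow_eq_id)
    then show ?thesis using yG by (simp add: pow_eq_id)
  qed
  then show ?thesis using prime_q y ord_eq_1[OF yG] yG by (auto simp: prime_nat_iff elements_of_order_def)
qed

lemma X_Int_centralizer:
  assumes x: "x \<in> X" shows "X \<inter> centralizer x = powers x - {\<one>}"
proof (intro equalityI subsetI)
  fix z assume "z \<in> X \<inter> centralizer x"
  then show "z \<in> powers x - {\<one>}"
    using mem_powers_of_commuting[OF fin prime_q not_sq_dvd] XD x prime_gt_1_nat[OF prime_q]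
    by (metis DiffI IntE less_irrefl ord_id singletonD)
next
  fix z assume z: "z \<in> powers x - {\<one>}"
  then have "x \<in> centralizer z" using powers_centralizer[OF XD(1)[OF x]] centralizer_self XD(1)[OF x] by blast
  moreover have "z \<in> X" using powers_minus_one[OF x] z by blast
  ultimately show "z \<in> X \<inter> centralizer x" using centralizer_sym XD by blast
qed

lemma card_X_Int_centralizer: "x \<in> X \<Longrightarrow> card (X \<inter> centralizer x) = q - 1"
  using X_Int_centralizer one_in_powers card_powers[OF fin] XD by (simp add: card_Diff_singleton_if)

lemma conjugate_X: "\<lbrakk>g \<in> carrier G; x \<in> X\<rbrakk> \<Longrightarrow> conjugate g x \<in> X"
  by (auto simp: elements_of_order_def)

lemma X_pow: "x \<in> X \<Longrightarrow> x [^] q = \<one>" using XD pow_ord_eq_1 by metis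

text \<open>Conjugation by some \<open>x\<close> of order \<open>q\<close> fixes exactly the
  \<open>q - 1\<close> nontrivial powers of \<open>x\<close>. This is Sylow's congruence, expressed
  in elements.\<close>

lemma dvd_card_X: "q dvd card X + 1"
proof -
  obtain x where x: "x \<in> X" using X_nonempty by blast
  have "[card X = q - 1] (mod q)"
    using conjugation_fixed_cong[OF prime_q XD(1)[OF x] X_pow[OF x] finite_X] conjugate_X XD x
    by (metis subsetI card_X_Int_centralizer)
  then have "[card X + 1 = q - 1 + 1] (mod q)" by (rule cong_add) simp
  then show ?thesis using prime_gt_1_nat[OF prime_q] by (simp add: cong_def mod_eq_0_iff_dvd)
qed

lemma centralizer_powers_eq:
  assumes x: "x \<in> X" and y: "y \<in> powers x" "y \<noteq> \<one>"
  shows "centralizer y = centralizer x"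
proof
  have yX: "y \<in> X" using powers_minus_one[OF x y] .
  show "centralizer x \<subseteq> centralizer y" using powers_centralizer[OF XD(1)[OF x] y(1)] .
  then have "x \<in> centralizer y" using centralizer_self XD(1)[OF x] by blast
  then have "x \<in> powers y" using X_Int_centralizer[OF yX] x by blast
  then show "centralizer y \<subseteq> centralizer x" using powers_centralizer[OF XD(1)[OF yX]] by blast
qed

text \<open>Sylow's conjugacy argument for elements: \<open>y\<close> commutes with exactly \<open>q - 1\<close> elements of the set \<open>S\<close>
  of conjugates of powers of \<open>y\<close>, so modulo \<open>q\<close> some element of \<open>S\<close> commutes with \<open>x\<close>.\<close>

lemma card_centralizer_eq:
  assumes x: "x \<in> X" and y: "y \<in> X"
  shows "card (centralizer x) = card (centralizer y)"
proof -
  define S where "S = (\<lambda>(g, z). conjugate g z) ` (carrier G \<times> (powers y - {\<one>}))"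
  have SX: "S \<subseteq> X" using conjugate_X powers_minus_one[OF y] by (auto simp: S_def)
  have Sc: "conjugate g s \<in> S" if g: "g \<in> carrier G" and s: "s \<in> S" for g s
  proof -
    obtain h z where hz: "h \<in> carrier G" "z \<in> powers y - {\<one>}" "s = conjugate h z" using s by (auto simp: S_def)
    then have "z \<in> carrier G" using powers_minus_one[OF y] XD by blast
    then have "conjugate g s = conjugate (g \<otimes> h) z" using g hz by (simp add: conjugate_mult)
    then show ?thesis using g hz unfolding S_def by (intro image_eqI[of _ _ "(g \<otimes> h, z)"]) auto
  qed
  have cong: "[card S = card (S \<inter> centralizer w)] (mod q)" if w: "w \<in> X" for w
    by (rule conjugation_fixed_cong[OF prime_q XD(1)[OF w] X_pow[OF w]])
      (use SX XD(1) w Sc finite_subset[OF SX finite_X] in auto)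
  have "S \<inter> centralizer y = X \<inter> centralizer y"
  proof -
    have "powers y - {\<one>} \<subseteq> S"
    proof
      fix z assume z: "z \<in> powers y - {\<one>}"
      then have "z \<in> carrier G" using powers_minus_one[OF y] XD by blast
      then show "z \<in> S" using z unfolding S_def by (intro image_eqI[of _ _ "(\<one>, z)"]) auto
    qed
    then show ?thesis using SX X_Int_centralizer[OF y] by blast
  qed
  then have "card (S \<inter> centralizer y) = q - 1" using card_X_Int_centralizer[OF y] by simp
  then have "[card (S \<inter> centralizer x) = q - 1] (mod q)"
    using cong[OF x] cong[OF y] by (metis cong_sym cong_trans)
  then have "card (S \<inter> centralizer x) \<noteq> 0"
    using prime_gt_1_nat[OF prime_q] by (intro notI) (simp add: cong_def)
  then obtain w where w: "w \<in> S" "w \<in> centralizer x" by (metis IntE card.empty ex_in_conv)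
  then obtain g z where gz: "g \<in> carrier G" "z \<in> powers y - {\<one>}" "w = conjugate g z" by (auto simp: S_def)
  then have "z \<in> X" using powers_minus_one[OF y] by blast
  \<comment> \<open>\<open>w\<close> generates the same subgroup as \<open>x\<close>, and
    \<open>z\<close> the same as \<open>y\<close>, while \<open>w\<close> and \<open>z\<close> are
    conjugate; equality of the centralizer orders passes along this chain.\<close>
  have "w \<in> powers x - {\<one>}" using w SX X_Int_centralizer[OF x] by blast
  then have "card (centralizer x) = card (centralizer w)" using centralizer_powers_eq[OF x] by auto
  also have "\<dots> = card (centralizer z)" using gz \<open>z \<in> X\<close> XD by (simp add: card_centralizer_conjugate)
  also have "\<dots> = card (centralizer y)" using gz centralizer_powers_eq[OF y] by auto
  finally show ?thesis .
qed

lemma prime_power_elements_eq: "prime_power_elements q = insert \<one> X"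
proof (intro equalityI subsetI)
  fix x assume "x \<in> prime_power_elements q"
  then obtain k where x: "x \<in> carrier G" "ord x = q ^ k" by (auto simp: prime_power_elements_def)
  have "\<not> 2 \<le> k"
    using not_sq_dvd ord_dvd_group_order[OF x(1)] x(2) le_imp_power_dvd[of 2 k q] by (metis dvd_trans)
  then have "k = 0 \<or> k = 1" by auto
  then show "x \<in> insert \<one> X" using x ord_eq_1[OF x(1)] by (auto simp: elements_of_order_def)
next
  fix x assume "x \<in> insert \<one> X"
  then have "x \<in> carrier G" "ord x = q ^ 0 \<or> ord x = q ^ 1" by (auto simp: elements_of_order_def)
  then show "x \<in> prime_power_elements q" unfolding prime_power_elements_def by blast
qed

text \<open>Sort C(x) by q-parts: its elements of \<open>q\<close>-power order are the
  \<open>q\<close> powers of \<open>x\<close>, and each of them is central in C(x).\<close>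

lemma card_centralizer:
  assumes x: "x \<in> X"
  shows "card (centralizer x) = q * card (centralizer x \<inter> regular_elements q)"
proof -
  note sub = centralizer_subgroup[OF XD(1)[OF x]]
  interpret C: group "G\<lparr>carrier := centralizer x\<rparr>" using subgroup_imp_group[OF sub] .
  have "\<one> \<in> centralizer x" using XD[OF x] by (simp add: centralizer_def)
  then have cp: "centralizer x \<inter> insert \<one> X = powers x" using X_Int_centralizer[OF x] one_in_powers by blast
  have "card (centralizer x) = (\<Sum>z\<in>powers x. card (centralizer x \<inter> centralizer z \<inter> (centralizer x \<inter> regular_elements q)))"
    using C.order_eq_sum_regular[OF _ prime_q] finite_subset[OF centralizer_sub fin]
    unfolding regular_elements_subgroup[OF sub] prime_power_elements_subgroup[OF sub]
      centralizer_in_subgroup[OF sub] prime_power_elements_eq cp by (simp add: order_def)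
  also have "\<dots> = (\<Sum>z\<in>powers x. card (centralizer x \<inter> regular_elements q))"
    using powers_centralizer[OF XD(1)[OF x]] by (intro sum.cong arg_cong[of _ _ card]) auto
  also have "\<dots> = q * card (centralizer x \<inter> regular_elements q)" using card_powers[OF fin] XD[OF x] by simp
  finally show ?thesis .
qed

lemma card_centralizer_dvd: "x \<in> carrier G \<Longrightarrow> card (centralizer x) dvd order G"
  using card_conj_class[OF fin] by (metis dvd_triv_right)

text \<open>Each \<open>z\<close> of order \<open>q\<close> is the q-part of |C(z)| / q elements,
  and all these centralizers have the same order. The factor \<open>q\<close> on the left avoids the
  division.\<close>

lemma sum_multiplicity:
  assumes x: "x \<in> X"
  shows "q * (\<Sum>g\<in>carrier G. multiplicity q (ord g)) = card X * card (centralizer x)"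
proof -
  have "\<one> \<notin> X" using prime_gt_1_nat[OF prime_q] by (auto simp: elements_of_order_def)
  have m: "multiplicity q q = 1" using prime_q by (simp add: not_prime_0 multiplicity_self not_prime_unit)
  have "(\<Sum>g\<in>carrier G. multiplicity q (ord g)) =
    (\<Sum>z\<in>X. multiplicity q (ord z) * card (centralizer z \<inter> regular_elements q))"
    unfolding sum_multiplicity_ord[OF fin prime_q] prime_power_elements_eq
    using \<open>\<one> \<notin> X\<close> finite_X by simp
  also have "\<dots> = (\<Sum>z\<in>X. card (centralizer z \<inter> regular_elements q))"
    using XD m by (intro sum.cong) auto
  finally have "q * (\<Sum>g\<in>carrier G. multiplicity q (ord g)) = (\<Sum>z\<in>X. card (centralizer z))"
    by (simp add: sum_distrib_left flip: card_centralizer)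
  also have "\<dots> = (\<Sum>z\<in>X. card (centralizer x))" using card_centralizer_eq[OF _ x] by (intro sum.cong) auto
  finally show ?thesis by simp
qed

lemma sum_multiplicity_eq_card:
  "(\<Sum>g\<in>carrier G. multiplicity q (ord g)) = card {g \<in> carrier G. q dvd ord g}"
proof -
  have "multiplicity q (ord g) = (if q dvd ord g then 1 else 0)" if g: "g \<in> carrier G" for g
  proof (cases "q dvd ord g")
    case True
    have "\<not> q ^ 2 dvd ord g" using not_sq_dvd ord_dvd_group_order[OF g] dvd_trans by blast
    then have "multiplicity q (ord g) = 1" using True
      by (intro multiplicity_eqI) (auto simp: numeral_2_eq_2)
    then show ?thesis using True by simp
  qed (simp add: not_dvd_imp_multiplicity_0)
  then have "(\<Sum>g\<in>carrier G. multiplicity q (ord g)) = (\<Sum>g\<in>carrier G. if q dvd ord g then 1 else 0)"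
    by (intro sum.cong) auto
  also have "\<dots> = card {g \<in> carrier G. q dvd ord g}" using fin by (simp add: sum.If_cases Int_def)
  finally show ?thesis .
qed

end

section \<open>Order and centre determined by the exponents\<close>

text \<open>The three numbers will be the exponents of 2, 3 and 5. Each candidate set omits exactly
  the prime that owns the exponent, and only \<open>p\<close> lies in all three; this is what makes
  the owners recognizable.\<close>

lemma prime_dvd_rho_values:
  fixes p r :: nat
  assumes "prime p" "prime r"
  shows "r dvd 15 * p \<Longrightarrow> r \<in> {3, 5, p}" "r dvd 20 * p \<Longrightarrow> r \<in> {2, 5, p}" "r dvd 24 * p \<Longrightarrow> r \<in> {2, 3, p}"
proof -
  have pr: "prime (2::nat)" "prime (3::nat)" "prime (5::nat)" by simp_all
  note eq = primes_dvd_imp_eq[OF assms(2)]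
  { assume "r dvd 15 * p"
    then have "r dvd 3 * (5 * p)" by simp
    then show "r \<in> {3, 5, p}" using eq pr assms(1) unfolding prime_dvd_mult_iff[OF assms(2)] by blast }
  { assume "r dvd 20 * p"
    then have "r dvd 2 * (2 * (5 * p))" by simp
    then show "r \<in> {2, 5, p}" using eq pr assms(1) unfolding prime_dvd_mult_iff[OF assms(2)] by blast }
  { assume "r dvd 24 * p"
    then have "r dvd 2 * (2 * (2 * (3 * p)))" by simp
    then show "r \<in> {2, 3, p}" using eq pr assms(1) unfolding prime_dvd_mult_iff[OF assms(2)] by blast }
qed

lemma prime_gt_5_not_dvd_60: "prime (p::nat) \<Longrightarrow> p > 5 \<Longrightarrow> \<not> p dvd 60"
proof
  assume p: "prime p" "p > 5" "p dvd 60"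
  then have "p dvd 2 * (2 * (3 * 5))" by simp
  then show False using p(2) unfolding prime_dvd_mult_iff[OF p(1)] by (auto dest: dvd_imp_le)
qed

context group
begin

definition rho_exponent :: "nat \<Rightarrow> nat" where
  "rho_exponent q = (\<Sum>g\<in>carrier G. multiplicity q (ord g))"

lemma rho_exponent_pos_imp_dvd:
  assumes "0 < rho_exponent q" shows "q dvd order G"
proof -
  obtain g where g: "g \<in> carrier G" "multiplicity q (ord g) \<noteq> 0"
    using assms by (metis rho_exponent_def less_irrefl sum.neutral)
  then have "q dvd ord g" using not_dvd_imp_multiplicity_0[of q "ord g"] by argo
  then show ?thesis using ord_dvd_group_order[OF g(1)] dvd_trans by blast
qed

text \<open>\<open>r\<close> divides the q'-part of |G|, which divides e_q. This is the test that
  matches unlabelled exponents with primes.\<close>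

lemma prime_dvd_rho_exponent:
  assumes fin: "finite (carrier G)" and q: "prime q" and r: "prime r" "r \<noteq> q" "r dvd order G"
  shows "r dvd rho_exponent q"
proof -
  have "order G \<noteq> 0" using fin order_gt_0_iff_finite by simp
  then obtain m where om: "order G = q ^ multiplicity q (order G) * m" "\<not> q dvd m"
    using multiplicity_decompose' q not_prime_unit by metis
  have "\<not> r dvd q ^ multiplicity q (order G)" using r q by (metis prime_dvd_power primes_dvd_imp_eq)
  then have "r dvd m" using r om by (metis prime_dvd_mult_iff)
  then show ?thesis using dvd_sum_multiplicity_ord[OF fin q om] by (simp add: rho_exponent_def dvd_trans)
qed

lemma order_dvd_rho_exponent:
  assumes fin: "finite (carrier G)" and q: "prime q"
  obtains a m where "order G = q ^ a * m" "\<not> q dvd m" "m dvd rho_exponent q"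
proof -
  have "order G \<noteq> 0" using fin order_gt_0_iff_finite by simp
  then obtain m where om: "order G = q ^ multiplicity q (order G) * m" "\<not> q dvd m"
    using multiplicity_decompose' q not_prime_unit by metis
  then show ?thesis using that dvd_sum_multiplicity_ord[OF fin q om] by (simp add: rho_exponent_def)
qed

lemma order_eq_60_mult:
  assumes fin: "finite (carrier G)" and p: "prime p" "p > 5"
    and ex: "rho_exponent ` {q. prime q \<and> 0 < rho_exponent q} = {15 * p, 20 * p, 24 * p, 60 * (p - 1)}"
  shows "order G = 60 * p" "rho_exponent 2 = 15 * p" "rho_exponent 3 = 20 * p"
    "rho_exponent 5 = 24 * p" "rho_exponent p = 60 * (p - 1)"
proof -
  let ?Q = "{q. prime q \<and> 0 < rho_exponent q}"
  have obt: "\<exists>q. prime q \<and> rho_exponent q = v" if "v \<in> {15 * p, 20 * p, 24 * p, 60 * (p - 1)}" for v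
    using that unfolding ex[symmetric] by blast
  obtain q1 where q1: "prime q1" "rho_exponent q1 = 15 * p" using obt[of "15 * p"] by blast
  obtain q2 where q2: "prime q2" "rho_exponent q2 = 20 * p" using obt[of "20 * p"] by blast
  obtain q3 where q3: "prime q3" "rho_exponent q3 = 24 * p" using obt[of "24 * p"] by blast
  obtain q4 where q4: "prime q4" "rho_exponent q4 = 60 * (p - 1)" using obt[of "60 * (p - 1)"] by blast
  note q = q1(1) q2(1) q3(1) q4(1) and e = q1(2) q2(2) q3(2) q4(2)
  have ne: "q1 \<noteq> q2" "q1 \<noteq> q3" "q1 \<noteq> q4" "q2 \<noteq> q3" "q2 \<noteq> q4" "q3 \<noteq> q4"
    using e p(2) by auto
  have dv: "q1 dvd order G" "q2 dvd order G" "q3 dvd order G" "q4 dvd order G"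
    by (rule rho_exponent_pos_imp_dvd, use e p(2) in simp)+
  note d = prime_dvd_rho_exponent[OF fin]
  note aux = prime_dvd_rho_values[OF p(1)]
  have 1: "q2 \<in> {3, 5, p}" "q3 \<in> {3, 5, p}" "q4 \<in> {3, 5, p}"
    using d[OF q(1)] e(1) aux(1) q dv ne by metis+
  have 2: "q1 \<in> {2, 5, p}" "q3 \<in> {2, 5, p}" "q4 \<in> {2, 5, p}"
    using d[OF q(2)] e(2) aux(2) q dv ne by metis+
  have 3: "q1 \<in> {2, 3, p}" "q2 \<in> {2, 3, p}" "q4 \<in> {2, 3, p}"
    using d[OF q(3)] e(3) aux(3) q dv ne by metis+
  \<comment> \<open>\<open>q4\<close> lies in all three candidate sets, so it is \<open>p\<close>;
    with \<open>p\<close> taken, the two sets containing each other prime meet in a single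
    element.\<close>
  have "q4 = p" "q1 = 2" "q2 = 3" "q3 = 5" using 1 2 3 ne p(2) by auto
  then show e': "rho_exponent 2 = 15 * p" "rho_exponent 3 = 20 * p"
    "rho_exponent 5 = 24 * p" "rho_exponent p = 60 * (p - 1)" using e by simp_all
  have dvd: "2 dvd order G" "3 dvd order G" "5 dvd order G" "p dvd order G"
    using dv \<open>q4 = p\<close> \<open>q1 = 2\<close> \<open>q2 = 3\<close> \<open>q3 = 5\<close> by simp_all
  have pr: "prime (2::nat)" "prime (3::nat)" "prime (5::nat)" by simp_all
  have np: "\<not> p dvd 60" using prime_gt_5_not_dvd_60[OF p] .
  have cop: "coprime p k" if "k dvd 60" for k
    using np prime_imp_coprime[OF p(1), of 60] that by (meson coprime_divisors dvd_refl)
  have "30 dvd order G"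
  proof -
    have "3 * 5 dvd order G" by (rule divides_mult) (use dvd primes_coprime[OF pr(2,3)] in auto)
    then have "2 * 15 dvd order G" by (intro divides_mult) (use dvd in auto)
    then show ?thesis by simp
  qed
  then have 30: "p * 30 dvd order G" using dvd cop[of 30] by (intro divides_mult) auto
  obtain a m where am: "order G = 2 ^ a * m" "m dvd 15 * p"
    using order_dvd_rho_exponent[OF fin pr(1)] e' by metis
  obtain b l where bl: "order G = 3 ^ b * l" "l dvd 20 * p"
    using order_dvd_rho_exponent[OF fin pr(2)] e' by metis
  \<comment> \<open>Being prime to 3, \<open>2 ^ a\<close> divides \<open>l\<close> and hence
    \<open>20 * p\<close>, so it divides 4. Together with the odd bound \<open>15 * p\<close> for
    \<open>m\<close> this gives |G| dividing \<open>60 * p\<close>.\<close>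
  have "2 ^ a dvd 3 ^ b * l" using am bl by (metis dvd_triv_left)
  moreover have "coprime (2 ^ a) (3 ^ b :: nat)" by simp
  ultimately have "2 ^ a dvd l" by (simp only: coprime_dvd_mult_right_iff)
  from dvd_trans[OF this bl(2)] have "2 ^ a dvd 4 * (5 * p)" by simp
  moreover have "coprime (2 ^ a) (5 * p)"
    using prime_odd_nat[OF p(1)] p(2) by simp
  ultimately have "2 ^ a dvd (4::nat)" by (simp only: coprime_dvd_mult_left_iff)
  then have "order G dvd 4 * (15 * p)" unfolding am(1) using am(2) by (intro mult_dvd_mono)
  then obtain k where k: "4 * (15 * p) = order G * k" by blast
  obtain j where j: "order G = p * 30 * j" using 30 by blast
  have "30 * p * 2 = 30 * p * (j * k)" using k j by (simp add: ac_simps)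
  then have kj: "order G = p * 30 * j" "2 = j * k" using p(2) j by simp_all
  have "j dvd 2" using kj(2) by (metis dvd_triv_left)
  then have "j \<le> 2" by (rule dvd_imp_le) simp
  moreover have "j \<noteq> 0" by (rule notI) (use kj(2) in simp)
  ultimately have "j \<in> {1, 2}" by auto
  moreover have "j \<noteq> 1"
  proof
    assume "j = 1"
    then have o: "order G = p * 30" using kj by simp
    have "\<not> p ^ 2 dvd order G"
    proof
      assume "p ^ 2 dvd order G"
      then have "p dvd 30" using o p(2) by (simp add: power2_eq_square)
      then show False using np dvd_trans[of p 30 60] by simp
    qed
    \<comment> \<open>Since \<open>p\<close> divides |G| only once, e_p is a number of elements and
      cannot exceed |G| = 30p, whereas 60(p - 1) does.\<close>
    then interpret sylow_prime G p by unfold_locales (use fin p dvd in auto)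
    have "rho_exponent p \<le> order G"
      unfolding rho_exponent_def sum_multiplicity_eq_card order_def using fin by (intro card_mono) auto
    then show False using e' o p(2) by simp
  qed
  ultimately show "order G = 60 * p" using kj by auto
qed

lemma ord_dvd_card_subgroup:
  assumes "subgroup H G" "x \<in> H" shows "ord x dvd card H"
  using group.ord_dvd_group_order[OF subgroup_imp_group[OF assms(1)], of x] assms
  by (simp add: ord_subgroup order_def)

lemma subgroup_nat_pow_closed: "\<lbrakk>subgroup H G; x \<in> H\<rbrakk> \<Longrightarrow> x [^] (n::nat) \<in> H"
  by (induction n) (simp_all add: subgroup.one_closed subgroup.m_closed)

text \<open>The power of \<open>g\<close> with exponent \<open>ord g\<close> divided by
  \<open>q\<close> has order \<open>q\<close> and commutes with \<open>g\<close>.\<close>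

lemma centralizer_of_multiple_order:
  assumes "finite (carrier G)" "g \<in> carrier G" "q dvd ord g"
  shows "\<exists>x\<in>elements_of_order q. g \<in> centralizer x"
proof -
  have "ord g > 0" using ord_ge_1[OF assms(1,2)] by simp
  then obtain k where k: "ord g = q * k" "k > 0" "q > 0" using assms(3) by (auto elim: dvdE)
  then have "ord (g [^] k) = q" using ord_pow[OF assms(2), of k] by simp
  moreover have "g \<in> centralizer (g [^] k)" using assms(2) by (metis centralizer_power centralizer_self)
  ultimately show ?thesis using assms(2) by (auto simp: elements_of_order_def)
qed

text \<open>Let n be the number of elements of order 5 and c the order of their centralizers, so
  that n c = 120p. Once p divides c, one has c = 5pj and n j = 24, and n \<equiv> -1 modulo 5 leaves
  n = 4 or n = 24. For n = 4 the elements of odd and even order together are fewer than |G|. For n =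
  24 an element y of order p in C(x) commutes with every element of order 5, which makes C(y) too
  large to be proper.\<close>

lemma exists_central_element:
  assumes fin: "finite (carrier G)" and p: "prime p" "p > 5" and o: "order G = 60 * p"
    and e2: "rho_exponent 2 = 15 * p" and e5: "rho_exponent 5 = 24 * p" and ep: "rho_exponent p = 60 * (p - 1)"
  shows "\<exists>y \<in> carrier G. ord y = p \<and> centralizer y = carrier G"
proof -
  have np: "\<not> p dvd 60" using prime_gt_5_not_dvd_60[OF p] .
  have nsqp: "\<not> p ^ 2 dvd order G" using o np p by (simp add: power2_eq_square)
  have nsq5: "\<not> 5 ^ 2 dvd order G"
  proof
    assume "5 ^ 2 dvd order G"
    then have "5 dvd 12 * p" using o by simp
    then have "5 dvd (12::nat) \<or> 5 dvd p" using prime_dvd_mult_iff[of "5::nat"] by simp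
    then show False using primes_dvd_imp_eq[of 5 p] p by auto
  qed
  interpret P: sylow_prime G p by unfold_locales (use fin p o nsqp in auto)
  interpret F: sylow_prime G 5 by unfold_locales (use fin p o nsq5 in auto)
  have cG: "card (carrier G) = 60 * p" using o by (simp add: order_def)
  have singp: "card {g \<in> carrier G. p dvd ord g} = 60 * (p - 1)"
    using ep P.sum_multiplicity_eq_card by (simp add: rho_exponent_def)
  have regp: "card (regular_elements p) = 60"
  proof -
    have "carrier G = regular_elements p \<union> {g \<in> carrier G. p dvd ord g}" by (auto simp: regular_elements_def)
    then have "card (carrier G) = card (regular_elements p) + card {g \<in> carrier G. p dvd ord g}"
      using fin by (subst card_Un_disjoint[symmetric]) (auto simp: regular_elements_def)
    then show ?thesis using singp cG p(2) by simp
  qed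
  obtain x where x: "x \<in> F.X" using F.X_nonempty by blast
  have xG: "x \<in> carrier G" "ord x = 5" using F.XD x by auto
  note subx = centralizer_subgroup[OF xG(1)]
  define c where "c = card (centralizer x)"
  have X5c: "5 * (24 * p) = card F.X * c" using F.sum_multiplicity[OF x] e5 by (simp add: rho_exponent_def c_def)
  \<comment> \<open>Otherwise all \<open>24p\<close> elements of order divisible by 5 would have order prime to \<open>p\<close>, but only 60 do.\<close>
  have pc: "p dvd c"
  proof (rule ccontr)
    assume npc: "\<not> p dvd c"
    have "{g \<in> carrier G. 5 dvd ord g} \<subseteq> regular_elements p"
    proof
      fix g assume g: "g \<in> {g \<in> carrier G. 5 dvd ord g}"
      then obtain z where z: "z \<in> F.X" "g \<in> centralizer z" using centralizer_of_multiple_order[OF fin] by blast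
      then have "ord g dvd c" using F.card_centralizer_eq[OF z(1) x] F.XD
          ord_dvd_card_subgroup[OF centralizer_subgroup] by (metis c_def)
      then show "g \<in> regular_elements p" using npc g dvd_trans by (auto simp: regular_elements_def)
    qed
    then have "card {g \<in> carrier G. 5 dvd ord g} \<le> 60"
      using card_mono[OF finite_regular_elements[OF fin]] regp by metis
    then show False using e5 F.sum_multiplicity_eq_card p by (simp add: rho_exponent_def)
  qed
  have "5 dvd c" using F.card_centralizer[OF x] by (simp add: c_def)
  moreover have "coprime p 5" using primes_coprime[OF p(1), of 5] p by simp
  ultimately have "p * 5 dvd c" using pc by (simp add: divides_mult)
  then obtain j where j: "c = p * 5 * j" by blast
  then have "5 * p * 24 = 5 * p * (card F.X * j)" using X5c by (simp add: ac_simps)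
  then have Xj: "card F.X * j = 24" using p by (simp add: mult.commute)
  have "card F.X \<le> 24" using Xj by (metis dvd_imp_le dvd_triv_left zero_less_numeral)
  moreover have "5 dvd card F.X + 1" using F.dvd_card_X .
  \<comment> \<open>Of the values congruent to 4 modulo 5 up to 24, only 4 and 24 divide 24.\<close>
  ultimately have "card F.X = 4 \<or> card F.X = 9 \<or> card F.X = 14 \<or> card F.X = 19 \<or> card F.X = 24" by presburger
  then consider (four) "card F.X = 4" "j = 6" | (main) "card F.X = 24" "j = 1"
    using Xj by auto presburger+
  then show ?thesis
  proof cases
    case four
    have "card (F.X \<inter> centralizer x) = card F.X" using F.card_X_Int_centralizer[OF x] four by simp
    then have "F.X \<inter> centralizer x = F.X" using card_subset_eq[OF F.finite_X] by blast
    then have Xp: "F.X = powers x - {\<one>}" using F.X_Int_centralizer[OF x] by simp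
    \<comment> \<open>\<open>\<langle>x\<rangle>\<close> is normal with automorphism group of order 4, so elements of odd order centralize it;
      there are at least \<open>45p\<close> of them.\<close>
    have odd_in: "g \<in> centralizer x" if g: "g \<in> carrier G" "odd (ord g)" for g
    proof -
      have "conjugate g x \<in> powers x - {\<one>}" using F.conjugate_X[OF g(1) x] Xp by simp
      then obtain i where i: "conjugate g x = x [^] (i::nat)" "x [^] i \<noteq> \<one>" by (auto simp: powers_def)
      then have "\<not> 5 dvd i" using xG pow_eq_id by metis
      have it: "conjugate (g [^] n) x = x [^] (i ^ n)" for n :: nat
      proof (induction n)
        case (Suc n)
        have "conjugate (g [^] Suc n) x = conjugate (g [^] n) (conjugate g x)"
          using g xG by (simp add: conjugate_mult)
        also have "\<dots> = (x [^] (i ^ n)) [^] i" using Suc i g xG by (simp add: conjugate_pow)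
        finally show ?case using xG by (simp add: nat_pow_pow mult.commute)
      qed (use xG in simp)
      \<comment> \<open>A unit modulo 5 has fourth power 1, so \<open>g [^] 4\<close> commutes with
        \<open>x\<close>; as \<open>ord g\<close> is odd, \<open>g\<close> is a power of
        \<open>g [^] 4\<close>.\<close>
      have "i mod 5 \<in> {1, 2, 3, 4}" using \<open>\<not> 5 dvd i\<close> by (auto simp: dvd_eq_mod_eq_0)
      then have "(i mod 5) ^ 4 mod 5 = 1" by auto
      then have "[i ^ 4 = 1] (mod 5)" by (simp add: cong_def power_mod)
      then have "conjugate (g [^] (4::nat)) x = x" using it[of 4] pow_cong[OF xG(1), of "i ^ 4" 1 5] xG by simp
      then have 4: "g [^] (4::nat) \<in> centralizer x" using conjugate_fixed_iff[of "g [^] (4::nat)" x] g xG by (simp add: centralizer_def)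
      have "coprime 4 (ord g)" using g(2) by (metis coprime_left_2_iff_odd coprime_mult_left_iff mult_2 numeral_Bit0)
      then obtain v where "[4 * v = 1] (mod ord g)" using cong_solve_coprime_nat by (metis One_nat_def)
      then have "(g [^] (4::nat)) [^] v = g" using pow_cong[OF g(1), of "4 * v" 1 "ord g"] g by (simp add: nat_pow_pow)
      moreover have "(g [^] (4::nat)) [^] v \<in> centralizer x"
        using 4 subgroup_nat_pow_closed[OF subx] by blast
      ultimately show ?thesis by simp
    qed
    have "card {g \<in> carrier G. even (ord g)} \<le> 15 * p"
    proof -
      have "card {g \<in> carrier G. even (ord g)} = (\<Sum>g\<in>carrier G. if even (ord g) then 1 else 0)"
        using fin by (simp add: sum.If_cases Int_def)
      also have "\<dots> \<le> rho_exponent 2" unfolding rho_exponent_def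
      proof (rule sum_mono)
        fix g assume g: "g \<in> carrier G"
        have "ord g \<noteq> 0" using ord_ge_1[OF fin g] by simp
        then show "(if even (ord g) then 1 else 0) \<le> multiplicity 2 (ord g)"
          by (auto intro: multiplicity_geI)
      qed
      finally show ?thesis using e2 by simp
    qed
    \<comment> \<open>With \<open>j = 6\<close> the centralizer has order \<open>30 * p\<close>;
      adding the \<open>15 * p\<close> for even orders falls short of \<open>60 * p\<close>.\<close>
    moreover have "card {g \<in> carrier G. odd (ord g)} \<le> 30 * p"
    proof -
      have "card {g \<in> carrier G. odd (ord g)} \<le> card (centralizer x)"
        by (rule card_mono) (use odd_in finite_subset[OF centralizer_sub fin] in auto)
      then show ?thesis using j four by (simp add: c_def)
    qed
    moreover have "card (carrier G) = card {g \<in> carrier G. even (ord g)} + card {g \<in> carrier G. odd (ord g)}"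
      using fin by (subst card_Un_disjoint[symmetric]) (auto intro!: arg_cong[of _ _ card])
    ultimately show ?thesis using cG p by simp
  next
    case main
    interpret Cx: group "G\<lparr>carrier := centralizer x\<rparr>" using subgroup_imp_group[OF subx] .
    obtain y where "y \<in> centralizer x" "ord y = p"
      using Cx.cauchy[OF _ p(1)] pc finite_subset[OF centralizer_sub fin] ord_subgroup[OF subx]
      by (auto simp: order_def c_def)
    then have y: "y \<in> P.X" "x \<in> centralizer y" using centralizer_sub centralizer_sym xG
      by (auto simp: elements_of_order_def)
    have yG: "y \<in> carrier G" using P.XD y by auto
    note suby = centralizer_subgroup[OF yG]
    have cyd: "card (centralizer y) dvd order G" using P.card_centralizer_dvd[OF yG] .
    interpret Cy: sylow_prime "G\<lparr>carrier := centralizer y\<rparr>" 5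
    proof (rule sylow_prime.intro[OF subgroup_imp_group[OF suby]], unfold_locales)
      show "5 dvd order (G\<lparr>carrier := centralizer y\<rparr>)"
        using ord_dvd_card_subgroup[OF suby y(2)] xG by (simp add: order_def)
      show "\<not> 5\<^sup>2 dvd order (G\<lparr>carrier := centralizer y\<rparr>)"
        using nsq5 cyd dvd_trans unfolding order_def by auto
    qed (use finite_subset[OF centralizer_sub fin] in auto)
    \<comment> \<open>\<open>N\<close> is constrained twice: modulo 5 by the element count inside
      C(y), and modulo \<open>p\<close> because \<open>y\<close> permutes the 24 elements of order 5
      by conjugation.\<close>
    define N where "N = card (F.X \<inter> centralizer y)"
    have "5 dvd N + 1" using Cy.dvd_card_X by (simp add: elements_of_order_subgroup[OF suby] N_def Int_commute)
    moreover have "N \<le> 24" using main card_mono[OF F.finite_X, of "F.X \<inter> centralizer y"] by (simp add: N_def)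
    ultimately have Nc: "N = 4 \<or> N = 9 \<or> N = 14 \<or> N = 19 \<or> N = 24" by presburger
    have "[card F.X = N] (mod p)" unfolding N_def
      by (rule conjugation_fixed_cong[OF p(1) yG P.X_pow[OF y(1)] F.finite_X]) (use F.conjugate_X yG F.XD in auto)
    \<comment> \<open>The nonzero candidates for \<open>24 - N\<close> are 5, 10, 15 and 20, all of
      them divisors of 60, which \<open>p\<close> does not divide.\<close>
    then have "p dvd 24 - N" using \<open>N \<le> 24\<close> main by (simp add: cong_altdef_nat)
    then have "\<not> 24 - N dvd 60" using np dvd_trans by blast
    then have "N = 24" using Nc by auto
    then have "F.X \<inter> centralizer y = F.X" using main card_subset_eq[OF F.finite_X] by (simp add: N_def)
    then have X5C: "insert \<one> F.X \<subseteq> centralizer y \<inter> regular_elements p"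
      using p yG primes_dvd_imp_eq[OF p(1), of 5]
      by (auto simp: regular_elements_def elements_of_order_def centralizer_def dest: dvd_imp_le)
    \<comment> \<open>|C(y)| will be \<open>p * w\<close>. The 24 elements of order 5 and the
      identity give \<open>w\<close> \<ge> 25, and \<open>w\<close> divides 60, which leaves 30 and
      60.\<close>
    define w where "w = card (centralizer y \<inter> regular_elements p)"
    have "\<one> \<notin> F.X" by (auto simp: elements_of_order_def)
    then have "card (insert \<one> F.X) = 25" using main F.finite_X by simp
    then have w25: "w \<ge> 25" using card_mono[OF _ X5C] finite_subset[OF centralizer_sub fin] by (simp add: w_def)
    have cy: "card (centralizer y) = p * w" using P.card_centralizer[OF y(1)] by (simp add: w_def)
    then have "p * w dvd p * 60" using cyd o by (simp add: mult.commute)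
    then have "w dvd 60" using p by simp
    then obtain k where k: "60 = w * k" by blast
    have "p * (60 * (p - 1)) = card P.X * (p * w)"
      using P.sum_multiplicity[OF y(1)] ep cy by (simp add: rho_exponent_def)
    then have Xw: "60 * (p - 1) = card P.X * w" using p by simp
    have "k \<noteq> 0" using k by (intro notI) simp
    have "k < 3"
    proof (rule ccontr)
      assume "\<not> k < 3"
      then have "25 * 3 \<le> w * k" using w25 by (intro mult_le_mono) auto
      then show False using k by simp
    qed
    with \<open>k \<noteq> 0\<close> have "k = 1 \<or> k = 2" by auto
    \<comment> \<open>\<open>w = 30\<close> would give 2(p - 1) elements of order \<open>p\<close>,
      that is -2 instead of -1 modulo \<open>p\<close>.\<close>
    moreover have "k \<noteq> 2"
    proof
      assume "k = 2"
      then have "w = 30" using k by simp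
      then have "card P.X = 2 * (p - 1)" using Xw by simp
      then have "p dvd 2 * (p - 1) + 1" using P.dvd_card_X by simp
      moreover have "2 * (p - 1) + 1 + 1 = 2 * p" using p by simp
      ultimately have "p dvd 1" by (metis dvd_add_right_iff dvd_triv_right)
      then show False using p by simp
    qed
    ultimately have "w = 60" using k by simp
    then have "card (centralizer y) = card (carrier G)" using cy cG by simp
    then have "centralizer y = carrier G" using card_subset_eq[OF fin centralizer_sub] by blast
    then show ?thesis using yG P.XD[OF y(1)] by blast
  qed
qed

end

section \<open>Transfer into a central subgroup\<close>

context group
begin

text \<open>\<open>V\<close> is the transfer. \<open>t g C\<close> compares the representative of
  \<open>C\<close> multiplied by \<open>g\<close> with the representative of \<open>C #> g\<close>;
  both lie in one coset, so the quotient is in \<open>Z\<close>. As right multiplication permutes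
  the cosets, the telescoping rule \<open>t_mult\<close> makes the product over all cosets
  multiplicative. An element of \<open>Z\<close> fixes every coset, so each factor of its transfer
  is that element.\<close>

lemma transfer_to_central_subgroup:
  assumes fin: "finite (carrier G)" and Z: "subgroup Z G" and central: "\<And>z. z \<in> Z \<Longrightarrow> centralizer z = carrier G"
  shows "\<exists>V \<in> hom G (G\<lparr>carrier := Z\<rparr>). \<forall>z\<in>Z. V z = z [^] card (rcosets Z)"
proof -
  let ?K = "G\<lparr>carrier := Z\<rparr>"
  have ZG: "z \<in> carrier G" if "z \<in> Z" for z using that Z subgroup.mem_carrier by fastforce
  have comm: "z \<otimes> g = g \<otimes> z" if "z \<in> Z" "g \<in> carrier G" for z g
  proof -
    have "g \<in> centralizer z" using central that by simp
    then show ?thesis by (simp add: centralizer_def)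
  qed
  interpret K: comm_group ?K
  proof (rule group.group_comm_groupI[OF subgroup_imp_group[OF Z]])
    show "x \<otimes>\<^bsub>?K\<^esub> y = y \<otimes>\<^bsub>?K\<^esub> x" if "x \<in> carrier ?K" "y \<in> carrier ?K" for x y
      using comm[of x y] ZG that by simp
  qed
  define R where "R = rcosets Z"
  define r where "r C = (SOME x. x \<in> C)" for C :: "'a set"
  define t where "t g C = r C \<otimes> g \<otimes> inv (r (C #> g))" for g C
  define V where "V g = finprod ?K (t g) R" for g
  have finR: "finite R" using finite_subset[OF rcosets_subset_PowG[OF Z]] fin by (simp add: R_def)
  have RD: "\<exists>x\<in>carrier G. C = Z #> x" if "C \<in> R" for C using that by (auto simp: R_def RCOSETS_def)
  have shift: "C #> g \<in> R" "C #> g #> h = C #> (g \<otimes> h)" if C: "C \<in> R" and g: "g \<in> carrier G" "h \<in> carrier G" for C g h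
  proof -
    obtain x where x: "x \<in> carrier G" "C = Z #> x" using RD C by blast
    have "Z \<subseteq> carrier G" using ZG by blast
    then show "C #> g \<in> R" "C #> g #> h = C #> (g \<otimes> h)"
      using x g by (simp_all add: coset_mult_assoc m_assoc R_def rcosetsI)
  qed
  have rC: "r C \<in> C" if "C \<in> R" for C
  proof -
    obtain x where "x \<in> carrier G" "C = Z #> x" using RD \<open>C \<in> R\<close> by blast
    then have "x \<in> C" using rcos_self[OF _ Z] by simp
    then show ?thesis unfolding r_def by (rule someI)
  qed
  have CG: "C \<subseteq> carrier G" if "C \<in> R" for C
    using that RD r_coset_subset_G[of Z] ZG by blast
  have quot: "a \<otimes> inv b \<in> Z" if C: "C \<in> R" and ab: "a \<in> C" "b \<in> C" for C a b
  proof -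
    obtain x where x: "x \<in> carrier G" "C = Z #> x" using RD C by blast
    then obtain u v where uv: "u \<in> Z" "a = u \<otimes> x" "v \<in> Z" "b = v \<otimes> x"
      using ab by (auto simp: r_coset_def)
    then have "a \<otimes> inv b = u \<otimes> inv v"
      using x ZG by (simp add: inv_mult_group m_assoc inv_solve_left) (simp add: m_assoc[symmetric])
    then show ?thesis using uv Z by (simp add: subgroup.m_closed subgroup.m_inv_closed)
  qed
  have tZ: "t g C \<in> Z" if "C \<in> R" "g \<in> carrier G" for g C
  proof -
    have "r C \<otimes> g \<in> C #> g" using rC[OF that(1)] by (auto simp: r_coset_def)
    then show ?thesis unfolding t_def using quot[OF shift(1)[OF that(1,2,2)]] rC shift(1)[OF that(1,2,2)] by blast
  qed
  have rG: "r C \<in> carrier G" if "C \<in> R" for C using rC CG that by blast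
  have t_mult: "t (g \<otimes> h) C = t g C \<otimes> t h (C #> g)" if C: "C \<in> R" and g: "g \<in> carrier G" and h: "h \<in> carrier G" for g h C
  proof -
    note G = rG[OF C] rG[OF shift(1)[OF C g h]] rG[OF shift(1)[OF shift(1)[OF C g h] h h]] g h
    have cancel: "inv (r (C #> g)) \<otimes> (r (C #> g) \<otimes> w) = w" if "w \<in> carrier G" for w
      using G that by (simp flip: m_assoc)
    have "t g C \<otimes> t h (C #> g) = r C \<otimes> g \<otimes> h \<otimes> inv (r (C #> g #> h))"
      using G cancel unfolding t_def by (simp add: m_assoc)
    also have "\<dots> = t (g \<otimes> h) C" using G shift(2)[OF C g h] by (simp add: t_def m_assoc)
    finally show ?thesis by simp
  qed
  have perm: "inj_on (\<lambda>C. C #> g) R" "(\<lambda>C. C #> g) ` R = R" if g: "g \<in> carrier G" for g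
  proof -
    show inj: "inj_on (\<lambda>C. C #> g) R"
    proof (rule inj_on_inverseI)
      fix C assume C: "C \<in> R"
      show "C #> g #> inv g = C" using shift(2)[OF C g inv_closed[OF g]] g coset_mult_one[OF CG[OF C]] by simp
    qed
    show "(\<lambda>C. C #> g) ` R = R"
      by (rule endo_inj_surj[OF finR _ inj]) (use shift(1) g in auto)
  qed
  have "V \<in> hom G ?K"
  proof (rule homI)
    show "V g \<in> carrier ?K" if "g \<in> carrier G" for g
      unfolding V_def using tZ that by (intro K.finprod_closed) auto
    fix g h assume g: "g \<in> carrier G" and h: "h \<in> carrier G"
    have "V (g \<otimes> h) = finprod ?K (\<lambda>C. t g C \<otimes>\<^bsub>?K\<^esub> t h (C #> g)) R"
      unfolding V_def using tZ t_mult g h shift(1) K.m_closed by (intro K.finprod_cong') auto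
    also have "\<dots> = finprod ?K (t g) R \<otimes>\<^bsub>?K\<^esub> finprod ?K (\<lambda>C. t h (C #> g)) R"
      using tZ g h shift(1) by (intro K.finprod_multf) auto
    also have "finprod ?K (\<lambda>C. t h (C #> g)) R = finprod ?K (t h) ((\<lambda>C. C #> g) ` R)"
      using K.finprod_reindex[of "t h" "\<lambda>C. C #> g" R] perm[OF g] tZ h by auto
    finally show "V (g \<otimes> h) = V g \<otimes>\<^bsub>?K\<^esub> V h" using perm[OF g] by (simp add: V_def)
  qed
  moreover have "V z = z [^] card R" if z: "z \<in> Z" for z
  proof -
    have "t z C = z" if C: "C \<in> R" for C
    proof -
      obtain x where x: "x \<in> carrier G" "C = Z #> x" using RD C by blast
      have "C #> z = Z #> (x \<otimes> z)" using x ZG[OF z] ZG by (simp add: coset_mult_assoc subsetI)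
      also have "\<dots> = Z #> z #> x" using x ZG[OF z] ZG comm[OF z x(1)] by (simp add: coset_mult_assoc subsetI)
      also have "\<dots> = C" using x subgroup.rcos_const[OF Z is_group z] by simp
      finally show ?thesis using rG[OF C] ZG[OF z] comm[OF z rG[OF C]] by (simp add: t_def flip: comm[OF z rG[OF C]]) (simp add: m_assoc)
    qed
    then have "V z = finprod ?K (\<lambda>_. z) R" unfolding V_def using z by (intro K.finprod_cong') auto
    also have "\<dots> = z [^]\<^bsub>?K\<^esub> card R" using z by (intro K.finprod_const) auto
    finally show ?thesis by (simp flip: nat_pow_consistent)
  qed
  ultimately show ?thesis unfolding R_def by blast
qed

text \<open>The complement is the kernel of the transfer. On \<open>powers y\<close> the transfer is
  the \<open>n\<close>-th power, a bijection because \<open>n\<close> is prime to \<open>p\<close>;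
  so the kernel meets \<open>powers y\<close> trivially and every transfer value is attained on
  \<open>powers y\<close>.\<close>

lemma central_complement:
  assumes fin: "finite (carrier G)" and y: "y \<in> carrier G" "ord y = p" "centralizer y = carrier G"
    and o: "order G = n * p" and cop: "coprime n p"
  shows "\<exists>H. subgroup H G \<and> card H = n \<and> G\<lparr>carrier := H\<rparr> \<times>\<times> integer_mod_group p \<cong> G"
proof -
  let ?Z = "powers y"
  let ?K = "G\<lparr>carrier := ?Z\<rparr>"
  have p0: "p > 0" using ord_ge_1[OF fin y(1)] y(2) by simp
  have Z: "subgroup ?Z G" using powers_subgroup[OF fin y(1)] .
  have cent: "centralizer z = carrier G" if "z \<in> ?Z" for z
    using powers_centralizer[OF y(1) that] y(3) centralizer_sub by blast
  have "card (rcosets ?Z) = n" using lagrange[OF Z] card_powers[OF fin y(1)] y(2) o p0 by simp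
  then obtain V where V: "V \<in> hom G ?K" "\<And>z. z \<in> ?Z \<Longrightarrow> V z = z [^] n"
    using transfer_to_central_subgroup[OF fin Z cent] by auto
  interpret V: group_hom G ?K V
    by (intro group_hom.intro group_hom_axioms.intro is_group subgroup_imp_group Z V(1))
  define H where "H = kernel G ?K V"
  have H: "subgroup H G" unfolding H_def using V.subgroup_kernel .
  have HD: "h \<in> carrier G" "V h = \<one>" if "h \<in> H" for h using that by (auto simp: H_def kernel_def)
  let ?P = "G\<lparr>carrier := H\<rparr> \<times>\<times> integer_mod_group p"
  have cP: "carrier ?P = H \<times> {0..<int p}" using p0 by (simp add: carrier_integer_mod_group)
  interpret P: group ?P by (rule DirProd_group[OF subgroup_imp_group[OF H] group_integer_mod_group])
  define f where "f = (\<lambda>(h, i). h \<otimes> y [^] nat i)"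
  have yV: "V (y [^] i) = y [^] (i * n)" for i :: nat
    using V(2)[of "y [^] i"] y by (auto simp: powers_def nat_pow_pow)
  have yc: "y [^] (i::nat) \<otimes> g = g \<otimes> y [^] i" if "g \<in> carrier G" for g i
  proof -
    have "g \<in> centralizer (y [^] i)" using cent[of "y [^] i"] that by (simp add: powers_def)
    then show ?thesis by (simp add: centralizer_def)
  qed
  have "f \<in> hom ?P G"
  proof (rule homI)
    show "f x \<in> carrier G" if "x \<in> carrier ?P" for x using that HD y by (auto simp: f_def)
    fix x x' assume "x \<in> carrier ?P" "x' \<in> carrier ?P"
    then obtain h i h' i' where x: "x = (h, i)" "x' = (h', i')" "h \<in> H" "h' \<in> H" "0 \<le> i" "0 \<le> i'"
      unfolding cP by auto
    have "[nat ((i + i') mod int p) = nat i + nat i'] (mod p)"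
      using x p0 by (simp add: cong_def nat_add_distrib nat_mod_distrib)
    then have "y [^] nat ((i + i') mod int p) = y [^] nat i \<otimes> y [^] nat i'"
      using pow_cong[OF y(1)] y by (simp add: nat_pow_mult)
    then have "f (x \<otimes>\<^bsub>?P\<^esub> x') = h \<otimes> h' \<otimes> (y [^] nat i \<otimes> y [^] nat i')"
      using x by (simp add: f_def)
    also have "\<dots> = h \<otimes> (h' \<otimes> y [^] nat i) \<otimes> y [^] nat i'" using x HD y by (simp add: m_assoc)
    also have "\<dots> = h \<otimes> (y [^] nat i \<otimes> h') \<otimes> y [^] nat i'" using x HD yc[of h' "nat i"] by simp
    also have "\<dots> = f x \<otimes> f x'" using x HD y by (simp add: f_def m_assoc)
    finally show "f (x \<otimes>\<^bsub>?P\<^esub> x') = f x \<otimes> f x'" .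
  qed
  then interpret f: group_hom ?P G f by unfold_locales
  have "f \<in> iso ?P G" unfolding f.iso_iff
  proof (intro conjI ballI impI subsetI)
    fix x assume "x \<in> carrier ?P" and fx: "f x = \<one>"
    then obtain h i where hi: "x = (h, i)" "h \<in> H" "0 \<le> i" "i < int p" unfolding cP by auto
    then obtain k where "i = int k" using nonneg_int_cases by metis
    with hi have x: "x = (h, int k)" "h \<in> H" "k < p" by simp_all
    have "V (f x) = V (y [^] k)" using x HD y V.hom_mult[of h "y [^] k"] V.H.l_one[OF V.hom_closed[OF nat_pow_closed[OF y(1)]], of k]
      by (simp add: f_def)
    then have "y [^] (k * n) = \<one>" using fx V.hom_one by (simp add: yV)
    then have "p dvd k * n" using y pow_eq_id by simp
    then have "p dvd k" using cop by (simp add: coprime_dvd_mult_left_iff coprime_commute)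
    then have "k = 0" using x by (auto dest!: dvd_imp_le)
    then show "x = \<one>\<^bsub>?P\<^esub>" using fx x HD by (simp add: f_def)
  next
    fix g assume g: "g \<in> carrier G"
    have "V g \<in> ?Z" using V.hom_closed[OF g] by simp
    then obtain k where k: "V g = y [^] (k::nat)" by (auto simp: powers_def)
    \<comment> \<open>If \<open>V g = y [^] k\<close>, then \<open>y [^] (k * l)\<close> has the
      same transfer as \<open>g\<close>. Reducing the exponent modulo \<open>p\<close> places it in
      the carrier of \<open>integer_mod_group p\<close>.\<close>
    obtain l where "[n * l = 1] (mod p)" using cong_solve_coprime_nat[OF cop] by auto
    then have "[k * (n * l) = k * 1] (mod p)" by (intro cong_mult cong_refl)
    moreover have "[k * l mod p = k * l] (mod p)" by simp
    then have "[(k * l mod p) * n = (k * l) * n] (mod p)" by (intro cong_mult cong_refl)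
    ultimately have "[(k * l mod p) * n = k] (mod p)" by (metis cong_trans mult.right_neutral mult.assoc mult.commute)
    then have Vy: "V (y [^] (k * l mod p)) = V g" using pow_cong[OF y(1)] y k by (simp add: yV)
    let ?h = "g \<otimes> inv (y [^] (k * l mod p))"
    have "V ?h = V g \<otimes> inv\<^bsub>?K\<^esub> V (y [^] (k * l mod p))" using g y by simp
    then have "V ?h = \<one>" using Vy V.hom_closed[OF g] V.H.r_inv by simp
    then have h: "?h \<in> H" using g y by (auto simp: H_def kernel_def)
    have "f (?h, int (k * l mod p)) = g" using g y by (simp add: f_def m_assoc)
    moreover have "(?h, int (k * l mod p)) \<in> carrier ?P" using h p0 unfolding cP by simp
    ultimately show "g \<in> f ` carrier ?P" by force
  qed
  then have iso: "?P \<cong> G" by (rule is_isoI)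
  have "card H * p = order G" using iso_same_card[OF iso] unfolding cP order_def by (simp add: card_cartesian_product)
  then have "card H = n" using o p0 by simp
  then show ?thesis using H iso by blast
qed

end

section \<open>Groups of order 60 with the order statistics of the alternating group\<close>

context group
begin

lemma commute_of_exponent_two:
  assumes "x \<in> carrier G" "y \<in> carrier G" "x \<otimes> x = \<one>" "y \<otimes> y = \<one>" "(x \<otimes> y) \<otimes> (x \<otimes> y) = \<one>"
  shows "x \<otimes> y = y \<otimes> x"
proof -
  have "inv x = x" "inv y = y" "inv (x \<otimes> y) = x \<otimes> y" using assms by (auto intro!: inv_equality)
  then show ?thesis using assms inv_mult_group by metis
qed

lemma ord_2_iff: "x \<in> carrier G \<Longrightarrow> ord x = 2 \<longleftrightarrow> x \<otimes> x = \<one> \<and> x \<noteq> \<one>"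
proof -
  assume x: "x \<in> carrier G"
  have "x \<otimes> x = \<one> \<longleftrightarrow> ord x dvd 2" using pow_eq_id[OF x, of 2] x by (simp add: numeral_2_eq_2)
  also have "\<dots> \<longleftrightarrow> ord x = 1 \<or> ord x = 2" using two_is_prime_nat prime_nat_iff by auto
  finally show ?thesis using ord_eq_1[OF x] by auto
qed

end

locale order_60_group = group G for G (structure) +
  assumes order_60: "order G = 60"
    and ords: "\<And>g. g \<in> carrier G \<Longrightarrow> ord g \<in> {1, 2, 3, 5}"
    and card_involutions: "card (elements_of_order 2) = 15"
begin

abbreviation involutions where "involutions \<equiv> elements_of_order 2"

text \<open>These are the Sylow 2-subgroups; describing them as centralizers makes their stability
  under conjugation immediate.\<close>

definition four_groups where "four_groups = centralizer ` involutions"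

lemma fin: "finite (carrier G)"
  using order_60 order_gt_0_iff_finite by simp

lemma finite_involutions: "finite involutions" using fin by (auto simp: elements_of_order_def)

lemma involutionD: "t \<in> involutions \<Longrightarrow> t \<in> carrier G" "t \<in> involutions \<Longrightarrow> ord t = 2" by (auto simp: elements_of_order_def)

lemma conjugate_involution: "\<lbrakk>g \<in> carrier G; t \<in> involutions\<rbrakk> \<Longrightarrow> conjugate g t \<in> involutions"
  by (auto simp: elements_of_order_def)

text \<open>An involution times a commuting element of order 3 or 5 would have order 6 or 10, which
  \<open>ords\<close> excludes.\<close>

lemma ord_in_centralizer:
  assumes t: "t \<in> involutions" and g: "g \<in> centralizer t"
  shows "ord g = 1 \<or> ord g = 2"
proof (rule ccontr)
  have gG: "g \<in> carrier G" "t \<otimes> g = g \<otimes> t" using g by (auto simp: centralizer_def)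
  assume "\<not> ?thesis"
  then have o: "ord g = 3 \<or> ord g = 5" using ords[OF gG(1)] by auto
  then have "coprime (ord t) (ord g)" using involutionD(2)[OF t] by auto
  then have "ord (t \<otimes> g) = 2 * ord g" using ord_mult_coprime[OF involutionD(1)[OF t] gG] involutionD(2)[OF t] by simp
  then have "ord (t \<otimes> g) = 6 \<or> ord (t \<otimes> g) = 10" using o by auto
  then show False using ords[of "t \<otimes> g"] involutionD(1)[OF t] gG(1) by auto
qed

lemma square_in_centralizer: "\<lbrakk>t \<in> involutions; g \<in> centralizer t\<rbrakk> \<Longrightarrow> g \<otimes> g = \<one>"
  using ord_in_centralizer ord_2_iff ord_eq_1 centralizer_sub by (metis One_nat_def l_one one_closed subsetD)

lemma card_centralizer_dvd_4:
  assumes t: "t \<in> involutions" shows "card (centralizer t) dvd 4"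
proof -
  note sub = centralizer_subgroup[OF involutionD(1)[OF t]]
  interpret C: group "G\<lparr>carrier := centralizer t\<rparr>" using subgroup_imp_group[OF sub] .
  have no: "\<not> r dvd card (centralizer t)" if r: "prime r" "r > 2" for r
  proof
    assume "r dvd card (centralizer t)"
    then obtain x where "x \<in> centralizer t" "ord x = r"
      using C.cauchy[OF _ r(1)] finite_subset[OF centralizer_sub fin] ord_subgroup[OF sub] by (auto simp: order_def)
    then show False using ord_in_centralizer[OF t, of x] r by auto
  qed
  have "coprime (card (centralizer t)) 3" "coprime (card (centralizer t)) 5"
    using no[of 3] no[of 5] prime_imp_coprime[of 3 "card (centralizer t)"] prime_imp_coprime[of 5 "card (centralizer t)"]
    by (simp_all add: coprime_commute)
  then have "coprime (card (centralizer t)) (3 * 5)" by (simp only: coprime_mult_right_iff)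
  moreover have "card (centralizer t) dvd 4 * (3 * 5)"
    using dvdI[of 60 "card (centralizer t)" "card (conj_class t)"] card_conj_class[OF fin involutionD(1)[OF t]] order_60
    by (simp add: mult.commute)
  ultimately show ?thesis by (simp only: coprime_dvd_mult_left_iff)
qed

text \<open>A Sylow subgroup of order 4 has exponent two, so it is abelian and fills the centralizer
  of any of its involutions \<open>s\<close>. The class of \<open>s\<close> then has 60/4 = 15
  elements, so it contains all involutions.\<close>

lemma card_centralizer_involution:
  assumes t: "t \<in> involutions" shows "card (centralizer t) = 4"
proof -
  have "prime (2::nat)" by simp
  then obtain V where V: "subgroup V G" "card V = 2 ^ 2"
    using sylow_thm[of 2 G 2 15] order_60 fin is_group by auto
  have VG: "V \<subseteq> carrier G" using V(1) subgroup.subset by blast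
  have sq: "x \<otimes> x = \<one>" if x: "x \<in> V" for x
  proof -
    interpret V: group "G\<lparr>carrier := V\<rparr>" using subgroup_imp_group[OF V(1)] .
    have "ord x dvd 4" using V.ord_dvd_group_order[of x] ord_subgroup[OF V(1) x] V x by (simp add: order_def)
    moreover have xG: "x \<in> carrier G" using x VG by blast
    ultimately have "ord x = 1 \<or> ord x = 2" using ords[OF xG] by auto
    then show ?thesis using ord_2_iff[OF xG] ord_eq_1[OF xG] by auto
  qed
  have "\<not> V \<subseteq> {\<one>}" using V(2) card_mono[of "{\<one>}" V] by auto
  then obtain s where s: "s \<in> V" "s \<noteq> \<one>" by blast
  then have s_inv: "s \<in> involutions" using sq VG ord_2_iff by (auto simp: elements_of_order_def)
  have "V \<subseteq> centralizer s"
  proof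
    fix x assume x: "x \<in> V"
    have "x \<otimes> s \<in> V" using V(1) x s by (simp add: subgroup.m_closed)
    then have "x \<otimes> s = s \<otimes> x" using commute_of_exponent_two[of x s] sq x s VG by blast
    then show "x \<in> centralizer s" using x VG by (auto simp: centralizer_def)
  qed
  then have "4 \<le> card (centralizer s)"
    using V(2) card_mono[OF finite_subset[OF centralizer_sub fin], of V s] by simp
  then have c4: "card (centralizer s) = 4" using card_centralizer_dvd_4[OF s_inv] by (auto dest: dvd_imp_le)
  have "card (conj_class s) = 15" using card_conj_class[OF fin involutionD(1)[OF s_inv]] c4 order_60 by simp
  moreover have "conj_class s \<subseteq> involutions" using conjugate_involution s_inv by (auto simp: conj_class_def)
  ultimately have "conj_class s = involutions" using card_subset_eq[OF finite_involutions] card_involutions by simp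
  then obtain g where "g \<in> carrier G" "t = conjugate g s" using t by (auto simp: conj_class_def)
  then show ?thesis using card_centralizer_conjugate involutionD(1)[OF s_inv] c4 by simp
qed

lemma centralizer_minus_one_subset: "t \<in> involutions \<Longrightarrow> centralizer t - {\<one>} \<subseteq> involutions"
  using square_in_centralizer[of t] ord_2_iff centralizer_sub[of t] unfolding elements_of_order_def by blast

text \<open>A centralizer of exponent two is abelian, so it is contained in the centralizer of each
  of its elements, and both have order 4. Thus four-groups sharing an involution coincide.\<close>

lemma centralizer_eq:
  assumes t: "t \<in> involutions" and s: "s \<in> centralizer t" "s \<noteq> \<one>"
  shows "centralizer s = centralizer t"
proof -
  have s_inv: "s \<in> involutions" using centralizer_minus_one_subset t s by blast
  have "centralizer t \<subseteq> centralizer s"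
  proof
    fix x assume x: "x \<in> centralizer t"
    have "x \<otimes> s \<in> centralizer t" using centralizer_subgroup[OF involutionD(1)[OF t]] x s by (simp add: subgroup.m_closed)
    then have "x \<otimes> s = s \<otimes> x"
      using commute_of_exponent_two[of x s] square_in_centralizer[OF t] x s centralizer_sub by blast
    then show "x \<in> centralizer s" using x by (simp add: centralizer_def)
  qed
  then show ?thesis
    using card_subset_eq[OF finite_subset[OF centralizer_sub fin]] card_centralizer_involution s_inv t by metis
qed

lemma four_groupD:
  assumes "A \<in> four_groups"
  shows "subgroup A G" "finite A" "card (A - {\<one>}) = 3" "A - {\<one>} \<subseteq> involutions" "\<And>s. s \<in> A - {\<one>} \<Longrightarrow> centralizer s = A"
proof -
  obtain t where t: "t \<in> involutions" "A = centralizer t" using assms by (auto simp: four_groups_def)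
  show sub: "subgroup A G" using t centralizer_subgroup involutionD by simp
  show "finite A" using t finite_subset[OF centralizer_sub fin] by simp
  then show "card (A - {\<one>}) = 3"
    using card_centralizer_involution[OF t(1)] t(2) subgroup.one_closed[OF sub] by (simp add: card_Diff_singleton)
  show "A - {\<one>} \<subseteq> involutions" "\<And>s. s \<in> A - {\<one>} \<Longrightarrow> centralizer s = A"
    using centralizer_minus_one_subset[OF t(1)] centralizer_eq[OF t(1)] t(2) by auto
qed

lemma finite_four_groups: "finite four_groups" using finite_involutions by (simp add: four_groups_def)

text \<open>The map from an involution to its centralizer has the triples
  \<open>A - {\<one>}\<close> as fibres, and 15/3 = 5.\<close>

lemma card_four_groups: "card four_groups = 5"
proof -
  have fiber: "{t \<in> involutions. centralizer t = A} = A - {\<one>}" if "A \<in> four_groups" for A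
  proof (intro equalityI subsetI)
    fix t assume t: "t \<in> {t \<in> involutions. centralizer t = A}"
    then have "t \<in> A" using centralizer_self involutionD by blast
    moreover have "t \<noteq> \<one>" using t by (auto simp: elements_of_order_def)
    ultimately show "t \<in> A - {\<one>}" by simp
  next
    fix t assume "t \<in> A - {\<one>}"
    then show "t \<in> {t \<in> involutions. centralizer t = A}" using four_groupD(4,5)[OF that] by blast
  qed
  have "card involutions = (\<Sum>A\<in>centralizer ` involutions. \<Sum>t\<in>{t \<in> involutions. centralizer t = A}. 1)"
    using sum.image_gen[OF finite_involutions, of "\<lambda>_. 1::nat" centralizer] by simp
  also have "\<dots> = (\<Sum>A\<in>four_groups. 3)" unfolding four_groups_def[symmetric] using fiber four_groupD(3) by (intro sum.cong) auto
  finally show ?thesis using card_involutions by simp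
qed

lemma conjugate_four_group: "\<lbrakk>g \<in> carrier G; A \<in> four_groups\<rbrakk> \<Longrightarrow> conjugate g ` A \<in> four_groups"
  using centralizer_conjugate conjugate_involution involutionD by (auto simp: four_groups_def) (metis image_eqI)

lemma exists_other_four_group: "\<exists>B\<in>four_groups. B \<noteq> A"
proof (rule ccontr)
  assume "\<not> ?thesis"
  then have "four_groups \<subseteq> {A}" by blast
  then have "card four_groups \<le> 1" using card_mono[of "{A}" four_groups] by simp
  then show False using card_four_groups by simp
qed

text \<open>An element of prime order q \<noteq> 3 that stabilizes a four-group permutes its three
  involutions and commutes with one of them, since 3 is not 0 modulo q. Order 5 is impossible in a
  centralizer of an involution; order 2 would put \<open>g\<close> into every four-group, while it
  lies only in \<open>centralizer g\<close>.\<close>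

lemma fixes_all_imp_ord_ne:
  assumes g: "g \<in> carrier G" and fixed: "\<And>A. A \<in> four_groups \<Longrightarrow> conjugate g ` A = A"
  shows "ord g \<noteq> 2" "ord g \<noteq> 5"
proof -
  have cong: "[3 = card ((B - {\<one>}) \<inter> centralizer g)] (mod q)" if B: "B \<in> four_groups" and q: "prime q" "ord g = q" for B q
  proof -
    have "conjugate g s \<in> B - {\<one>}" if "s \<in> B - {\<one>}" for s
    proof -
      have "s \<in> carrier G" using that four_groupD(4)[OF B] involutionD by blast
      then show ?thesis using that fixed[OF B] conjugate_eq_one_iff[OF g] by blast
    qed
    then have "[card (B - {\<one>}) = card ((B - {\<one>}) \<inter> centralizer g)] (mod q)"
      using four_groupD[OF B] involutionD g pow_ord_eq_1[OF g] q by (intro conjugation_fixed_cong) auto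
    then show ?thesis using four_groupD(3)[OF B] by simp
  qed
  have common: "\<exists>s\<in>B - {\<one>}. s \<in> involutions \<and> g \<in> centralizer s" if B: "B \<in> four_groups" and q: "prime q" "ord g = q" "q \<noteq> 3" for B q
  proof -
    have "card ((B - {\<one>}) \<inter> centralizer g) \<noteq> 0"
      using cong[OF B q(1,2)] q(3) primes_dvd_imp_eq[OF q(1), of 3]
      by (intro notI) (auto simp: cong_0_iff)
    then obtain s where "s \<in> B - {\<one>}" "s \<in> centralizer g" by (metis IntE card.empty ex_in_conv)
    then show ?thesis using four_groupD(4)[OF B] involutionD centralizer_sym[OF g] by blast
  qed
  show "ord g \<noteq> 5"
  proof
    assume o: "ord g = 5"
    obtain B where "B \<in> four_groups" using exists_other_four_group by blast
    then show False using common[of B 5] o ord_in_centralizer[of _ g] by auto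
  qed
  show "ord g \<noteq> 2"
  proof
    assume o: "ord g = 2"
    obtain B where B: "B \<in> four_groups" "B \<noteq> centralizer g" using exists_other_four_group by blast
    then obtain s where s: "s \<in> B - {\<one>}" "g \<in> centralizer s" using common[of B 2] o by auto
    then have "g \<in> B - {\<one>}" using four_groupD(5)[OF B(1) s(1)] o ord_id by auto
    then show False using four_groupD(5)[OF B(1)] B(2) by blast
  qed
qed

theorem iso_alt_group_5: "G \<cong> alt_group 5"
proof -
  obtain b where b: "bij_betw b {1..5::nat} four_groups"
    using ex_bij_betw_nat_finite_1[OF finite_four_groups] card_four_groups by auto
  define b' where "b' = inv_into {1..5} b"
  have bb: "b (b' A) = A" "b' A \<in> {1..5}" if "A \<in> four_groups" for A
    using bij_betw_imp_surj_on[OF b] that inv_into_into[of A b] f_inv_into_f[of A b] unfolding b'_def by blast+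
  have bb': "b' (b i) = i" "b i \<in> four_groups" if "i \<in> {1..5}" for i
    using bij_betw_inv_into_left[OF b that] bij_betwE[OF b] that unfolding b'_def by blast+
  define f where "f g i = (if i \<in> {1..5} then b' (conjugate g ` b i) else i)" for g i
  have four_group_subset: "A \<subseteq> carrier G" if "A \<in> four_groups" for A using four_groupD(1)[OF that] subgroup.subset by blast
  have conj_mult: "conjugate g ` conjugate h ` A = conjugate (g \<otimes> h) ` A" if "A \<in> four_groups" "g \<in> carrier G" "h \<in> carrier G" for g h A
    using four_group_subset[OF that(1)] that by (auto simp: image_image conjugate_mult subset_iff intro!: image_cong)
  have f_mult: "f (g \<otimes> h) = f g \<circ> f h" if g: "g \<in> carrier G" and h: "h \<in> carrier G" for g h
  proof
    fix i show "f (g \<otimes> h) i = (f g \<circ> f h) i"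
      using bb bb' conjugate_four_group conj_mult g h by (auto simp: f_def)
  qed
  have f_one: "f \<one> = id"
  proof
    fix i
    have "conjugate \<one> ` b i = b i" if "i \<in> {1..5}"
      using four_group_subset[OF bb'(2)[OF that]] by (force simp: image_iff subset_iff)
    then show "f \<one> i = id i" using bb' by (auto simp: f_def)
  qed
  have f_perm: "f g permutes {1..5}" if g: "g \<in> carrier G" for g
  proof (rule bij_imp_permutes)
    have into: "f h i \<in> {1..5}" if "h \<in> carrier G" "i \<in> {1..5}" for h i
      using bb(2)[OF conjugate_four_group[OF that(1) bb'(2)[OF that(2)]]] that(2) by (simp add: f_def)
    have "f (inv g) (f g i) = i" "f g (f (inv g) i) = i" for i
      using f_mult[of "inv g" g] f_mult[of g "inv g"] g f_one by (metis comp_apply id_apply inv_closed l_inv, metis comp_apply id_apply inv_closed r_inv)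
    then show "bij_betw (f g) {1..5} {1..5}"
      using into g by (intro bij_betw_byWitness[where f' = "f (inv g)"]) auto
  qed (auto simp: f_def)
  have f_hom: "f \<in> hom G (sym_group 5)"
    by (rule homI) (use f_perm f_mult in \<open>auto simp: sym_group_carrier sym_group_mult\<close>)
  interpret f: group_hom G "sym_group 5" f
    by (intro group_hom.intro group_hom_axioms.intro is_group sym_group_is_group f_hom)
  have fixed: "conjugate g ` A = A" if "g \<in> carrier G" "f g = id" "A \<in> four_groups" for g A
  proof -
    have "f g (b' A) = b' A" using that by simp
    then have "b' (conjugate g ` A) = b' A" using bb[OF that(3)] by (simp add: f_def)
    then show ?thesis using bb(1)[OF that(3)] bb(1)[OF conjugate_four_group[OF that(1,3)]] by metis
  qed
  have ker: "g = \<one>" if g: "g \<in> carrier G" "f g = id" for g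
  proof (rule ccontr)
    assume "g \<noteq> \<one>"
    then have o: "ord g = 3" using fixes_all_imp_ord_ne[OF g(1)] fixed[OF g] ords[OF g(1)] ord_eq_1[OF g(1)] by auto
    obtain B where B: "B \<in> four_groups" using exists_other_four_group by blast
    have "B - {\<one>} \<noteq> {}" using four_groupD(3)[OF B] by (metis card.empty zero_neq_numeral)
    then obtain t where t: "t \<in> B - {\<one>}" by blast
    then have t_inv: "t \<in> involutions" and tG: "t \<in> carrier G" using four_groupD(4)[OF B] involutionD by auto
    \<comment> \<open>The commutator of \<open>g\<close> and \<open>t\<close> lies in the kernel
      and, as \<open>g\<close> stabilizes \<open>B\<close>, also in \<open>B\<close>. It is
      nontrivial because \<open>g\<close> has order 3 and cannot centralize \<open>t\<close>; so it
      is an involution in the kernel.\<close>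
    define c where "c = conjugate g t \<otimes> inv t"
    have cB: "c \<in> B" unfolding c_def
      using fixed[OF g B] t four_groupD(1)[OF B] by (auto intro!: subgroup.m_closed subgroup.m_inv_closed)
    have c1: "c \<noteq> \<one>"
    proof
      assume "c = \<one>"
      then have "conjugate g t = t" using g tG inv_equality[of "conjugate g t" "inv t"] by (simp add: c_def)
      then have "g \<in> centralizer t" using g tG conjugate_fixed_iff by (simp add: centralizer_def)
      then show False using ord_in_centralizer[OF t_inv, of g] o by auto
    qed
    have cG: "c \<in> carrier G" using cB four_group_subset[OF B] by blast
    have "f c = id"
    proof -
      have "c = g \<otimes> (t \<otimes> inv g \<otimes> inv t)" using g tG by (simp add: c_def conjugate_def m_assoc)
      moreover have "f (inv g) = id" "f t \<circ> f (inv t) = id"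
        using f_mult[of "inv g" g] f_mult[of t "inv t"] f_one g tG by simp_all
      ultimately show ?thesis using g tG by (simp add: sym_group_mult)
    qed
    moreover have "ord c = 2" using four_groupD(4)[OF B] cB c1 involutionD by blast
    ultimately show False using fixes_all_imp_ord_ne(1)[OF cG] fixed[OF cG] by blast
  qed
  have inj: "inj_on f (carrier G)"
    using f.inj_on_one_iff ker by (simp add: sym_group_one)
  have sg: "group_hom G sign_img (sign \<circ> f)"
    by (intro group_hom.intro group_hom_axioms.intro is_group sign_img_is_group Group.hom_compose[OF f_hom sign_is_hom])
  interpret s: group_hom G sign_img "sign \<circ> f" by (rule sg)
  let ?N = "kernel G sign_img (sign \<circ> f)"
  have subN: "subgroup ?N G" by (rule s.subgroup_kernel)
  have "carrier G - involutions \<subseteq> ?N"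
  proof
    fix g assume g: "g \<in> carrier G - involutions"
    then have "ord g \<in> {1, 3, 5}" using ords[of g] by (auto simp: elements_of_order_def)
    \<comment> \<open>With this \<open>k\<close>, \<open>g\<close> is the square of
      \<open>g [^] k\<close>, so its permutation is even. This covers the 60 - 15 = 45 elements that
      are not involutions.\<close>
    then obtain k where k: "2 * k = ord g + 1" by (auto intro: that[of 1] that[of 2] that[of 3])
    have "g [^] k \<otimes> g [^] k = g [^] (2 * k)" using g by (simp add: nat_pow_mult mult_2)
    also have "\<dots> = g" unfolding k using g by simp
    finally have "sign (f g) = sign (f (g [^] k)) * sign (f (g [^] k))"
      using s.hom_mult[of "g [^] k" "g [^] k"] g by (simp add: sign_img_def)
    then have "sign (f g) = 1" by (simp add: sign_def split: if_splits)
    then show "g \<in> ?N" using g by (simp add: kernel_def sign_img_def)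
  qed
  moreover have "card (carrier G - involutions) = 45"
    using card_Diff_subset[OF finite_involutions, of "carrier G"] involutionD card_involutions order_60 by (auto simp: order_def)
  ultimately have "45 \<le> card ?N"
    using card_mono[of ?N "carrier G - involutions"] finite_subset[OF _ fin, of ?N] by (auto simp: kernel_def)
  moreover obtain m where m: "60 = m * card ?N" using lagrange[OF subN] order_60 by metis
  \<comment> \<open>\<open>m\<close> is the index of the kernel of the sign, which contains more
    than half of the 60 elements.\<close>
  moreover have "m < 2"
  proof (rule ccontr)
    assume "\<not> m < 2"
    then have "2 * 45 \<le> m * card ?N" using \<open>45 \<le> card ?N\<close> by (intro mult_le_mono) auto
    then show False using m by simp
  qed
  ultimately have "card ?N = card (carrier G)" using order_60 by (cases m) (auto simp: order_def less_2_cases_iff)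
  then have "?N = carrier G" using card_subset_eq[OF fin, of ?N] by (auto simp: kernel_def)
  then have even: "evenperm (f g)" if "g \<in> carrier G" for g
    using that by (auto simp: kernel_def sign_img_def sign_def split: if_splits)
  have img: "f ` carrier G \<subseteq> carrier (alt_group 5)" using f_perm even by (auto simp: alt_group_carrier)
  have "card (carrier (alt_group 5)) = 60" using alt_group_card_carrier[of 5] by (simp add: fact_numeral)
  moreover from this have "finite (carrier (alt_group 5))" using card.infinite by fastforce
  ultimately have "f ` carrier G = carrier (alt_group 5)"
    using card_subset_eq[OF _ img] card_image[OF inj] order_60 by (simp add: order_def)
  then have "f \<in> iso G (alt_group 5)"
    using f_mult inj by (auto simp: iso_def hom_def bij_betw_def alt_group_mult)
  then show ?thesis by (rule is_isoI)
qed

end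

section \<open>Element orders in PSL(2,5)\<close>

lemma UNIV_5: "(UNIV :: 5 set) = {0, 1, 2, 3, 4}"
proof -
  have "x \<in> {0, 1, 2, 3, 4}" for x :: 5
  proof (cases x rule: bit1_cases)
    case (of_int z)
    then have "z = 0 \<or> z = 1 \<or> z = 2 \<or> z = 3 \<or> z = 4" by auto
    then show ?thesis using of_int(1) by auto
  qed
  then show ?thesis by auto
qed

lemma forall_5: "(\<forall>x::5. P x) \<longleftrightarrow> P 0 \<and> P 1 \<and> P 2 \<and> P 3 \<and> P 4"
proof -
  have "(\<forall>x::5. P x) \<longleftrightarrow> (\<forall>x\<in>UNIV. P x)" by simp
  then show ?thesis by (simp only: UNIV_5) simp
qed

lemma sum_5: "(\<Sum>x\<in>UNIV. f (x::5)) = f 0 + f 1 + f 2 + f 3 + f 4"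
  unfolding UNIV_5 by (simp add: add.assoc)

definition mat2 :: "'a \<Rightarrow> 'a \<Rightarrow> 'a \<Rightarrow> 'a \<Rightarrow> 'a::comm_ring_1^2^2" where
  "mat2 a b c d = (\<chi> i j. if i = 1 then (if j = 1 then a else b) else (if j = 1 then c else d))"

lemma mat2_nth [simp]: "mat2 a b c d $ 1 $ 1 = a" "mat2 a b c d $ 1 $ 2 = b"
  "mat2 a b c d $ 2 $ 1 = c" "mat2 a b c d $ 2 $ 2 = d"
  by (simp_all add: mat2_def)

lemma mat2_eq_iff: "A = B \<longleftrightarrow> A $ 1 $ 1 = B $ 1 $ 1 \<and> A $ 1 $ 2 = B $ 1 $ 2 \<and> A $ 2 $ 1 = B $ 2 $ 1 \<and> A $ 2 $ 2 = B $ 2 $ 2"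
  for A B :: "'a^2^2"
  by (auto simp: vec_eq_iff forall_2)

lemma mat2_mult_nth:
  fixes A B :: "'a::comm_ring_1^2^2"
  shows "(A ** B) $ 1 $ 1 = A $ 1 $ 1 * B $ 1 $ 1 + A $ 1 $ 2 * B $ 2 $ 1"
    "(A ** B) $ 1 $ 2 = A $ 1 $ 1 * B $ 1 $ 2 + A $ 1 $ 2 * B $ 2 $ 2"
    "(A ** B) $ 2 $ 1 = A $ 2 $ 1 * B $ 1 $ 1 + A $ 2 $ 2 * B $ 2 $ 1"
    "(A ** B) $ 2 $ 2 = A $ 2 $ 1 * B $ 1 $ 2 + A $ 2 $ 2 * B $ 2 $ 2"
  by (simp_all add: matrix_matrix_mult_def sum_2)

lemma mat_1_nth: "(mat 1 :: 'a::comm_ring_1^2^2) $ 1 $ 1 = 1" "(mat 1 :: 'a::comm_ring_1^2^2) $ 1 $ 2 = 0"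
  "(mat 1 :: 'a::comm_ring_1^2^2) $ 2 $ 1 = 0" "(mat 1 :: 'a::comm_ring_1^2^2) $ 2 $ 2 = 1"
  by (simp_all add: mat_def)

lemma carrier_SL: "A \<in> carrier SL \<longleftrightarrow> det A = 1" by (simp add: SL_def)
lemma mult_SL [simp]: "A \<otimes>\<^bsub>SL\<^esub> B = A ** B" by (simp add: SL_def)
lemma one_SL [simp]: "\<one>\<^bsub>SL\<^esub> = mat 1" by (simp add: SL_def)

lemma group_SL2: "group (SL :: ('a::comm_ring_1^2^2) monoid)"
proof (rule groupI)
  fix A :: "'a^2^2" assume "A \<in> carrier SL"
  then have "A $ 1 $ 1 * A $ 2 $ 2 - A $ 1 $ 2 * A $ 2 $ 1 = 1" by (simp add: carrier_SL det_2)
  \<comment> \<open>The inverse is the adjugate matrix.\<close>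
  then show "\<exists>B\<in>carrier SL. B \<otimes>\<^bsub>SL\<^esub> A = \<one>\<^bsub>SL\<^esub>"
    by (intro bexI[of _ "mat2 (A $ 2 $ 2) (- A $ 1 $ 2) (- A $ 2 $ 1) (A $ 1 $ 1)"])
      (simp_all add: carrier_SL det_2 mat2_eq_iff mat2_mult_nth mat_1_nth algebra_simps)
qed (simp_all add: carrier_SL det_mul matrix_mul_assoc)

lemma (in group) group_centre_normal: "group_centre G \<lhd> G"
  unfolding normal_inv_iff
proof (intro conjI ballI subgroupI)
  show "group_centre G \<noteq> {}" by (auto simp: group_centre_def intro!: exI[of _ \<one>])
  show "inv a \<in> group_centre G" if "a \<in> group_centre G" for a
  proof -
    have a: "a \<in> carrier G" using that by (simp add: group_centre_def)
    have "inv a \<otimes> g = g \<otimes> inv a" if g: "g \<in> carrier G" for g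
    proof -
      have "a \<in> centralizer g" using g \<open>a \<in> group_centre G\<close> by (simp add: group_centre_def centralizer_def)
      then show ?thesis using subgroup.m_inv_closed[OF centralizer_subgroup[OF g]] by (simp add: centralizer_def)
    qed
    then show ?thesis using a by (simp add: group_centre_def)
  qed
  show "a \<otimes> b \<in> group_centre G" if ab: "a \<in> group_centre G" "b \<in> group_centre G" for a b
  proof -
    have a: "a \<in> carrier G" "b \<in> carrier G" using ab by (simp_all add: group_centre_def)
    have "(a \<otimes> b) \<otimes> g = g \<otimes> (a \<otimes> b)" if g: "g \<in> carrier G" for g
    proof -
      have "a \<in> centralizer g" "b \<in> centralizer g" using g ab by (simp_all add: group_centre_def centralizer_def)
      then show ?thesis using subgroup.m_closed[OF centralizer_subgroup[OF g]] by (simp add: centralizer_def)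
    qed
    then show ?thesis using a by (simp add: group_centre_def)
  qed
  show "x \<otimes> h \<otimes> inv x \<in> group_centre G" if "x \<in> carrier G" "h \<in> group_centre G" for x h
  proof -
    have "h \<in> carrier G" "x \<otimes> h = h \<otimes> x" using that by (simp_all add: group_centre_def)
    then have "x \<otimes> h \<otimes> inv x = h" using that by (simp add: m_assoc)
    then show ?thesis using that by simp
  qed
qed (auto simp: group_centre_def)

text \<open>Each coset satisfying \<open>P\<close> accounts for \<open>card H\<close>
  representatives, so counting in the quotient reduces to counting matrices.\<close>

lemma (in normal) card_FactGroup_filter:
  assumes fin: "finite (carrier G)"
  shows "card H * card {C \<in> carrier (G Mod H). P C} = card {a \<in> carrier G. P (H #> a)}"
proof -
  let ?S = "{a \<in> carrier G. P (H #> a)}"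
  have img: "(\<lambda>a. H #> a) ` ?S = {C \<in> carrier (G Mod H). P C}" by (auto simp: carrier_FactGroup)
  have fiber: "card {a \<in> ?S. H #> a = C} = card H" if C: "C \<in> (\<lambda>a. H #> a) ` ?S" for C
  proof -
    obtain b where b: "b \<in> carrier G" "C = H #> b" "P C" using C by auto
    have "{a \<in> ?S. H #> a = C} = C"
    proof (intro equalityI subsetI)
      fix a assume "a \<in> {a \<in> ?S. H #> a = C}"
      then show "a \<in> C" using rcos_self[OF _ subgroup_axioms] by auto
    next
      fix a assume a: "a \<in> C"
      then have "H #> b = H #> a" using b repr_independence[OF _ b(1) subgroup_axioms] by simp
      moreover have "a \<in> carrier G" using a b r_coset_subset_G[OF subset] by blast
      ultimately show "a \<in> {a \<in> ?S. H #> a = C}" using b by simp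
    qed
    moreover have "card C = card H"
      using card_rcosets_equal[OF _ subset] b rcosetsI[OF subset] by metis
    ultimately show ?thesis by simp
  qed
  have "card ?S = (\<Sum>C\<in>(\<lambda>a. H #> a) ` ?S. \<Sum>a\<in>{a \<in> ?S. H #> a = C}. 1)"
    using sum.image_gen[of ?S "\<lambda>_. 1::nat" "\<lambda>a. H #> a"] fin by simp
  also have "\<dots> = (\<Sum>C\<in>(\<lambda>a. H #> a) ` ?S. card H)" using fiber by (intro sum.cong) auto
  finally show ?thesis using img by simp
qed

text \<open>Product 0 has 5 + 5 - 1 = 9 solutions; for any other \<open>k\<close> each of the four
  nonzero \<open>b\<close> determines \<open>c\<close>.\<close>

lemma card_mult_eq_5: "card {(b::5, c::5). b * c = k} = (if k = 0 then 9 else 4)"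
proof -
  have "{(b::5, c::5). b * c = k} = (SIGMA b:UNIV. {c. b * c = k})" by auto
  then have "card {(b::5, c::5). b * c = k} = (\<Sum>b\<in>UNIV. card {c. b * c = k})" by (simp add: card_SigmaI)
  also have "\<dots> = (\<Sum>b\<in>UNIV. \<Sum>c\<in>UNIV. if b * c = k then 1 else 0)"
    by (simp add: sum.If_cases)
  also have "\<dots> = (if k = 0 then 9 else 4)"
    using forall_5[of "\<lambda>k. (\<Sum>b\<in>UNIV. \<Sum>c\<in>UNIV. if b * c = k then 1 else 0) = (if k = 0 then 9 else 4 :: nat)"]
    by (simp add: sum_5)
  finally show ?thesis .
qed

definition trace2 :: "'a::comm_ring_1^2^2 \<Rightarrow> 'a" where "trace2 A = A $ 1 $ 1 + A $ 2 $ 2"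

text \<open>By Cayley-Hamilton the trace determines the order of a non-central matrix modulo the centre.\<close>

lemma card_SL_trace:
  "card {A \<in> carrier SL. trace2 A = (t::5)} = (\<Sum>a\<in>UNIV. if a * (t - a) = 1 then 9 else 4)"
proof -
  \<comment> \<open>Trace \<open>t\<close> fixes the lower right entry as \<open>t - a\<close>, and
    determinant 1 prescribes the product of the off-diagonal entries.\<close>
  let ?f = "\<lambda>(a, b, c). mat2 a b c (t - a)"
  let ?S = "SIGMA a:UNIV. {(b::5, c::5). b * c = a * (t - a) - 1}"
  have "{A \<in> carrier SL. trace2 A = t} = ?f ` ?S"
  proof (intro equalityI subsetI)
    fix A assume "A \<in> {A \<in> carrier SL. trace2 A = t}"
    then have d: "A $ 2 $ 2 = t - A $ 1 $ 1" and "A $ 1 $ 1 * A $ 2 $ 2 - A $ 1 $ 2 * A $ 2 $ 1 = 1"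
      by (auto simp: carrier_SL trace2_def det_2)
    then have "A $ 1 $ 1 * (t - A $ 1 $ 1) - A $ 1 $ 2 * A $ 2 $ 1 = 1" by simp
    then have "A $ 1 $ 2 * A $ 2 $ 1 = A $ 1 $ 1 * (t - A $ 1 $ 1) - 1"
      by (simp add: diff_eq_eq eq_diff_eq add.commute)
    then show "A \<in> ?f ` ?S" using d
      by (intro image_eqI[of _ _ "(A $ 1 $ 1, A $ 1 $ 2, A $ 2 $ 1)"]) (auto simp: mat2_eq_iff)
  qed (auto simp: carrier_SL trace2_def det_2)
  moreover have "inj_on ?f ?S" by (auto simp: inj_on_def mat2_eq_iff)
  ultimately have "card {A \<in> carrier SL. trace2 A = t} = card ?S" by (simp add: card_image)
  also have "\<dots> = (\<Sum>a\<in>UNIV. card {(b::5, c::5). b * c = a * (t - a) - 1})"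
    by (subst card_SigmaI) auto
  also have "\<dots> = (\<Sum>a\<in>UNIV. if a * (t - a) = 1 then 9 else 4)"
    unfolding card_mult_eq_5 by (intro sum.cong) auto
  finally show ?thesis .
qed

text \<open>The condition a(t - a) = 1 says that a is a root of x^2 - t x + 1, which has two roots
  for t = 0, one for t = 2 and t = 3, and none for t = 1 and t = 4.\<close>

lemma card_SL_trace_values:
  "card {A \<in> carrier SL. trace2 A = (0::5)} = 30"
  "card {A \<in> carrier SL. trace2 A = (1::5)} = 20"
  "card {A \<in> carrier SL. trace2 A = (2::5)} = 25"
  "card {A \<in> carrier SL. trace2 A = (3::5)} = 25"
  "card {A \<in> carrier SL. trace2 A = (4::5)} = 20"
  unfolding card_SL_trace by (simp_all add: sum_5)

lemma group_centre_SL_2_5: "group_centre (SL :: (5^2^2) monoid) = {mat 1, - mat 1}"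
proof (intro equalityI subsetI)
  fix A :: "5^2^2" assume A: "A \<in> group_centre SL"
  \<comment> \<open>Commuting with these two unipotent matrices already forces a scalar
    matrix.\<close>
  have "mat2 1 1 0 1 \<in> carrier (SL :: (5^2^2) monoid)" "mat2 1 0 1 1 \<in> carrier (SL :: (5^2^2) monoid)"
    by (simp_all add: carrier_SL det_2)
  then have "A ** mat2 1 1 0 1 = mat2 1 1 0 1 ** A" "A ** mat2 1 0 1 1 = mat2 1 0 1 1 ** A"
    using A by (simp_all add: group_centre_def)
  then have e: "A $ 1 $ 2 = 0" "A $ 2 $ 1 = 0" "A $ 2 $ 2 = A $ 1 $ 1"
    by (auto simp: mat2_eq_iff mat2_mult_nth)
  moreover have "A $ 1 $ 1 * A $ 2 $ 2 - A $ 1 $ 2 * A $ 2 $ 1 = 1"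
    using A by (simp add: group_centre_def carrier_SL det_2)
  ultimately have "A $ 1 $ 1 * A $ 1 $ 1 = 1" by simp
  moreover have "\<forall>x::5. x * x = 1 \<longrightarrow> x = 1 \<or> x = - 1" unfolding forall_5 by simp
  ultimately have "A $ 1 $ 1 = 1 \<or> A $ 1 $ 1 = - 1" by blast
  then show "A \<in> {mat 1, - mat 1}" using e by (auto simp: mat2_eq_iff mat_1_nth)
next
  fix A :: "5^2^2" assume "A \<in> {mat 1, - mat 1}"
  then show "A \<in> group_centre SL"
    by (auto simp: group_centre_def carrier_SL det_2 mat_1_nth mat2_eq_iff mat2_mult_nth)
qed

text \<open>For determinant 1 Cayley-Hamilton reads A^2 = (tr A) A - 1, so x A + y times A is (x tr
  A + y) A - x; both sides are spelled out entrywise.\<close>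

lemma mat2_mult_Cayley_Hamilton:
  fixes A :: "'a::comm_ring_1^2^2"
  assumes "det A = 1"
  shows "mat2 (x * A $ 1 $ 1 + y) (x * A $ 1 $ 2) (x * A $ 2 $ 1) (x * A $ 2 $ 2 + y) ** A =
    mat2 ((x * trace2 A + y) * A $ 1 $ 1 - x) ((x * trace2 A + y) * A $ 1 $ 2)
      ((x * trace2 A + y) * A $ 2 $ 1) ((x * trace2 A + y) * A $ 2 $ 2 - x)"
proof -
  have "A $ 1 $ 1 * A $ 2 $ 2 = 1 + A $ 1 $ 2 * A $ 2 $ 1" using assms by (simp add: det_2 algebra_simps)
  then have "x * (A $ 1 $ 1 * A $ 2 $ 2) = x + x * (A $ 1 $ 2 * A $ 2 $ 1)" by (simp add: distrib_left)
  then show ?thesis by (simp add: mat2_eq_iff mat2_mult_nth trace2_def algebra_simps)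
qed

text \<open>Writing A^n = x A + y, the pair (x, y) starts at (0, 1) and moves to (x t + y, -x). The
  coefficient x is t, t^2 - 1 and t^4 - 3 t^2 + 1 for n = 2, 3, 5, and vanishes modulo 5 at the
  listed traces.\<close>

lemma SL_2_5_powers:
  fixes A :: "5^2^2"
  assumes A: "A \<in> carrier SL"
  shows "trace2 A = 0 \<Longrightarrow> A [^]\<^bsub>SL\<^esub> (2::nat) \<in> {mat 1, - mat 1}"
    "trace2 A \<in> {1, 4} \<Longrightarrow> A [^]\<^bsub>SL\<^esub> (3::nat) \<in> {mat 1, - mat 1}"
    "trace2 A \<in> {2, 3} \<Longrightarrow> A [^]\<^bsub>SL\<^esub> (5::nat) \<in> {mat 1, - mat 1}"
proof -
  let ?t = "trace2 A"
  let ?L = "\<lambda>x y. mat2 (x * A $ 1 $ 1 + y) (x * A $ 1 $ 2) (x * A $ 2 $ 1) (x * A $ 2 $ 2 + y)"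
  have step: "?L x y ** A = ?L (x * ?t + y) (- x)" for x y
    using mat2_mult_Cayley_Hamilton[of A x y] A by (simp add: carrier_SL)
  have 0: "A [^]\<^bsub>SL\<^esub> (0::nat) = ?L 0 1" by (simp add: mat2_eq_iff mat_1_nth)
  note pow = nat_pow_Suc[of SL A] step mult_SL 0
  have 2: "A [^]\<^bsub>SL\<^esub> (2::nat) = ?L ?t (- 1)"
    by (simp only: numeral_2_eq_2 pow) simp
  have 3: "A [^]\<^bsub>SL\<^esub> (3::nat) = ?L (?t * ?t - 1) (- ?t)"
    using 2 by (simp only: numeral_3_eq_3 numeral_2_eq_2 nat_pow_Suc[of SL A "Suc (Suc 0)"] mult_SL step) simp
  have 5: "A [^]\<^bsub>SL\<^esub> (5::nat) = ?L (((?t * ?t - 1) * ?t - ?t) * ?t + (1 - ?t * ?t)) (- ((?t * ?t - 1) * ?t - ?t))"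
  proof -
    have "(5::nat) = Suc (Suc 3)" by simp
    then show ?thesis using 3 by (simp only: nat_pow_Suc mult_SL step) simp
  qed
  \<comment> \<open>t^2 - 1 is 15 at t = 4, and t^4 - 3 t^2 + 1 is 5 at t = 2 and 55 at t =
    3.\<close>
  have modulus: "(5::5) = 0" "(15::5) = 0" "(55::5) = 0" by simp_all
  show "?t = 0 \<Longrightarrow> A [^]\<^bsub>SL\<^esub> (2::nat) \<in> {mat 1, - mat 1}"
    unfolding 2 by (simp add: mat2_eq_iff mat_1_nth)
  show "?t \<in> {1, 4} \<Longrightarrow> A [^]\<^bsub>SL\<^esub> (3::nat) \<in> {mat 1, - mat 1}"
    unfolding 3 by (auto simp: modulus mat2_eq_iff mat_1_nth)
  show "?t \<in> {2, 3} \<Longrightarrow> A [^]\<^bsub>SL\<^esub> (5::nat) \<in> {mat 1, - mat 1}"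
    unfolding 5 by (auto simp: modulus mat2_eq_iff mat_1_nth)
qed


section \<open>Passing from matrices to cosets of the centre\<close>

lemma group_PSL: "group (PSL :: ('a::comm_ring_1^2^2) set monoid)"
  unfolding PSL_def
  using normal.factorgroup_is_group[OF group.group_centre_normal[OF group_SL2]] .

lemma finite_carrier_SL: "finite (carrier (SL :: (5^2^2) monoid))"
  by (rule finite_subset[OF subset_UNIV]) simp

context
begin

interpretation SL: group "SL :: (5^2^2) monoid" by (rule group_SL2)

interpretation Z: normal "group_centre SL" "SL :: (5^2^2) monoid"
  by (rule SL.group_centre_normal)

interpretation PSL: group PSL_2_5 by (rule group_PSL)

private abbreviation Z where "Z \<equiv> group_centre (SL :: (5^2^2) monoid)"

private definition prime_of_trace :: "5 \<Rightarrow> nat" where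
  "prime_of_trace t = (if t = 0 then 2 else if t \<in> {1, 4} then 3 else 5)"

private lemma card_Z: "card Z = 2"
proof -
  have "(mat 1 :: 5^2^2) \<noteq> - mat 1" by (simp add: mat2_eq_iff mat_1_nth)
  then show ?thesis by (simp add: group_centre_SL_2_5)
qed

private lemma ord_coset:
  assumes A: "A \<in> carrier SL"
  shows "PSL.ord (Z #>\<^bsub>SL\<^esub> A) = (if A \<in> Z then 1 else prime_of_trace (trace2 A))"
proof -
  let ?C = "Z #>\<^bsub>SL\<^esub> A"
  have C: "?C \<in> carrier PSL_2_5" using A by (auto simp: PSL_def carrier_FactGroup)
  have one: "Z #>\<^bsub>SL\<^esub> B = \<one>\<^bsub>PSL_2_5\<^esub> \<longleftrightarrow> B \<in> Z" if "B \<in> carrier SL" for B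
    using SL.coset_join1[OF _ that Z.subgroup_axioms] SL.coset_join2[OF that Z.subgroup_axioms] by (auto simp: PSL_def)
  have pow: "?C [^]\<^bsub>PSL_2_5\<^esub> n = Z #>\<^bsub>SL\<^esub> (A [^]\<^bsub>SL\<^esub> n)" for n :: nat
    using Z.FactGroup_pow[OF A] by (simp add: PSL_def)
  have "trace2 A \<in> {0, 1, 2, 3, 4}" using UNIV_5 by blast
  then have "A [^]\<^bsub>SL\<^esub> prime_of_trace (trace2 A) \<in> Z"
    using SL_2_5_powers[OF A] unfolding group_centre_SL_2_5 by (auto simp: prime_of_trace_def)
  then have "?C [^]\<^bsub>PSL_2_5\<^esub> prime_of_trace (trace2 A) = \<one>\<^bsub>PSL_2_5\<^esub>"
    using one[OF SL.nat_pow_closed[OF A]] by (simp add: pow)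
  then have "PSL.ord ?C dvd prime_of_trace (trace2 A)" using PSL.pow_eq_id[OF C] by simp
  moreover have "prime (prime_of_trace (trace2 A))" by (simp add: prime_of_trace_def)
  ultimately have "PSL.ord ?C = 1 \<or> PSL.ord ?C = prime_of_trace (trace2 A)" by (auto simp: prime_nat_iff)
  moreover have "prime_of_trace (trace2 A) \<noteq> 1" by (simp add: prime_of_trace_def)
  ultimately show ?thesis using PSL.ord_eq_1[OF C] one[OF A] by auto
qed

private lemma trace_Z: "A \<in> Z \<Longrightarrow> trace2 A \<in> {2, 3}"
  by (auto simp: group_centre_SL_2_5 trace2_def mat_1_nth)

private lemma card_filter: "2 * card {C \<in> carrier PSL_2_5. P C} = card {A \<in> carrier SL. P (Z #>\<^bsub>SL\<^esub> A)}"
  using Z.card_FactGroup_filter[OF finite_carrier_SL, of P] by (simp add: card_Z PSL_def)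

private lemma card_trace_union: "finite T \<Longrightarrow> card {A \<in> carrier SL. trace2 A \<in> T} = (\<Sum>t\<in>T. card {A \<in> carrier SL. trace2 A = (t::5)})"
proof -
  assume T: "finite T"
  have "{A \<in> carrier SL. trace2 A \<in> T} = (\<Union>t\<in>T. {A \<in> carrier SL. trace2 A = t})" by auto
  then show ?thesis using T by (simp only:) (intro card_UN_disjoint, auto intro: finite_subset[OF _ finite_carrier_SL])
qed

private lemma card_carrier_SL: "card (carrier (SL :: (5^2^2) monoid)) = 120"
proof -
  have "carrier (SL :: (5^2^2) monoid) = {A \<in> carrier SL. trace2 A \<in> {0, 1, 2, 3, 4}}"
    using UNIV_5 by blast
  then show ?thesis using card_trace_union[of "{0, 1, 2, 3, 4}"] by (simp add: card_SL_trace_values)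
qed

lemma order_PSL_2_5: "order PSL_2_5 = 60"
  using card_filter[of "\<lambda>_. True"] card_carrier_SL by (simp add: order_def)

lemma ord_PSL_2_5:
  assumes "C \<in> carrier PSL_2_5" shows "PSL.ord C \<in> {1, 2, 3, 5}"
proof -
  obtain A where "A \<in> carrier SL" "C = Z #>\<^bsub>SL\<^esub> A" using assms by (auto simp: PSL_def carrier_FactGroup)
  then show ?thesis using ord_coset[of A] by (auto simp: prime_of_trace_def)
qed

lemma card_ord_PSL_2_5:
  "card {C \<in> carrier PSL_2_5. PSL.ord C = 2} = 15"
  "card {C \<in> carrier PSL_2_5. PSL.ord C = 3} = 20"
  "card {C \<in> carrier PSL_2_5. PSL.ord C = 5} = 24"
proof -
  have "PSL.ord (Z #>\<^bsub>SL\<^esub> A) = 2 \<longleftrightarrow> trace2 A = 0" if A: "A \<in> carrier SL" for A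
    using ord_coset[OF A] trace_Z[of A] by (auto simp: prime_of_trace_def)
  then have "{A \<in> carrier SL. PSL.ord (Z #>\<^bsub>SL\<^esub> A) = 2} = {A \<in> carrier SL. trace2 A = 0}" by auto
  then show "card {C \<in> carrier PSL_2_5. PSL.ord C = 2} = 15"
    using card_filter[of "\<lambda>C. PSL.ord C = 2"] by (simp add: card_SL_trace_values)
  have "PSL.ord (Z #>\<^bsub>SL\<^esub> A) = 3 \<longleftrightarrow> trace2 A \<in> {1, 4}" if A: "A \<in> carrier SL" for A
    using ord_coset[OF A] trace_Z[of A] by (auto simp: prime_of_trace_def)
  then have "{A \<in> carrier SL. PSL.ord (Z #>\<^bsub>SL\<^esub> A) = 3} = {A \<in> carrier SL. trace2 A \<in> {1, 4}}" by auto
  then show "card {C \<in> carrier PSL_2_5. PSL.ord C = 3} = 20"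
    using card_filter[of "\<lambda>C. PSL.ord C = 3"] card_trace_union[of "{1, 4}"] by (simp add: card_SL_trace_values)
  have "PSL.ord (Z #>\<^bsub>SL\<^esub> A) = 5 \<longleftrightarrow> trace2 A \<in> {2, 3} \<and> A \<notin> Z" if A: "A \<in> carrier SL" for A
  proof -
    have "trace2 A \<in> {0, 1, 2, 3, 4}" using UNIV_5 by blast
    then show ?thesis using ord_coset[OF A] by (auto simp: prime_of_trace_def)
  qed
  \<comment> \<open>The two central matrices have trace 2 or 3; removing them from the 25 + 25
    matrices of these traces leaves 48, that is 24 cosets.\<close>
  then have "{A \<in> carrier SL. PSL.ord (Z #>\<^bsub>SL\<^esub> A) = 5} = {A \<in> carrier SL. trace2 A \<in> {2, 3}} - Z" by auto
  moreover have "Z \<subseteq> {A \<in> carrier SL. trace2 A \<in> {2, 3}}" using trace_Z Z.subset by blast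
  moreover have "finite Z" by (simp add: group_centre_SL_2_5)
  ultimately have "card {A \<in> carrier SL. PSL.ord (Z #>\<^bsub>SL\<^esub> A) = 5} = 48"
    using card_trace_union[of "{2, 3}"] card_Z by (simp add: card_SL_trace_values card_Diff_subset)
  then show "card {C \<in> carrier PSL_2_5. PSL.ord C = 5} = 24"
    using card_filter[of "\<lambda>C. PSL.ord C = 5"] by simp
qed

end

section \<open>Exponents of the product of element orders\<close>

lemma Exp_rho_eq_rho_exponent:
  assumes "group G" "finite (carrier G)"
  shows "Exp_rho G = group.rho_exponent G ` {q. prime q \<and> 0 < group.rho_exponent G q}"
proof -
  interpret group G by fact
  have nz: "0 \<notin> ord ` carrier G" using ord_ge_1[OF assms(2)] by fastforce
  have "rho G \<noteq> 0" using nz assms(2) by (auto simp: rho_def)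
  moreover have "multiplicity q (rho G) = rho_exponent q" if "prime q" for q
    using prime_elem_multiplicity_prod_distrib[OF _ nz assms(2), of q] that
    by (simp add: rho_def rho_exponent_def)
  ultimately have "prime_factors (rho G) = {q. prime q \<and> 0 < rho_exponent q}"
    "\<And>q. q \<in> prime_factors (rho G) \<Longrightarrow> multiplicity q (rho G) = rho_exponent q"
    using prime_multiplicity_gt_zero_iff[OF prime_imp_prime_elem, of _ "rho G"]
    by (auto simp: in_prime_factors_iff)
  then show ?thesis unfolding Exp_rho_def Exp_def by (metis (no_types, lifting) image_cong)
qed

lemma rho_exponent_iso:
  assumes "group G" "group H" "G \<cong> H"
  shows "group.rho_exponent G q = group.rho_exponent H q"
proof -
  obtain h where h: "h \<in> iso G H" using assms(3) by (auto simp: is_iso_def)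
  interpret h: group_hom G H h
    using assms h by (auto simp: group_hom_def group_hom_axioms_def iso_def)
  have bij: "bij_betw h (carrier G) (carrier H)" using h by (simp add: iso_def)
  have "h.H.ord (h x) = h.G.ord x" if x: "x \<in> carrier G" for x
  proof (rule h.H.ord_eqI[OF h.hom_closed[OF x]])
    fix n :: nat
    have "h x [^]\<^bsub>H\<^esub> n = \<one>\<^bsub>H\<^esub> \<longleftrightarrow> h (x [^]\<^bsub>G\<^esub> n) = h \<one>\<^bsub>G\<^esub>" using h.hom_nat_pow[OF x] by simp
    also have "\<dots> \<longleftrightarrow> x [^]\<^bsub>G\<^esub> n = \<one>\<^bsub>G\<^esub>"
      using bij x by (intro inj_on_eq_iff[of h "carrier G"]) (auto simp: bij_betw_def)
    finally show "h x [^]\<^bsub>H\<^esub> n = \<one>\<^bsub>H\<^esub> \<longleftrightarrow> h.G.ord x dvd n" using h.G.pow_eq_id[OF x] by simp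
  qed
  then show ?thesis unfolding h.G.rho_exponent_def h.H.rho_exponent_def
    by (subst sum.reindex_bij_betw[OF bij, symmetric]) simp
qed

lemma ord_DirProd:
  assumes "group G" "group H" "x \<in> carrier G" "y \<in> carrier H"
  shows "group.ord (G \<times>\<times> H) (x, y) = lcm (group.ord G x) (group.ord H y)"
proof -
  interpret G: group G by fact
  interpret H: group H by fact
  interpret P: group "G \<times>\<times> H" by (rule DirProd_group) fact+
  have "(x, y) [^]\<^bsub>G \<times>\<times> H\<^esub> n = (x [^]\<^bsub>G\<^esub> n, y [^]\<^bsub>H\<^esub> n)" for n :: nat
    by (induction n) simp_all
  then show ?thesis using assms by (intro P.ord_eqI) (auto simp: G.pow_eq_id H.pow_eq_id)
qed

text \<open>Coprimality makes the order of a pair the product of the two orders, so multiplicities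
  add, and each element of one factor is paired with all elements of the other.\<close>

lemma rho_exponent_DirProd:
  assumes "group G" "group H" "finite (carrier G)" "finite (carrier H)"
    "coprime (order G) (order H)" "prime q"
  shows "group.rho_exponent (G \<times>\<times> H) q = order H * group.rho_exponent G q + order G * group.rho_exponent H q"
proof -
  interpret G: group G by fact
  interpret H: group H by fact
  interpret P: group "G \<times>\<times> H" by (rule DirProd_group) fact+
  have "multiplicity q (P.ord (x, y)) = multiplicity q (G.ord x) + multiplicity q (H.ord y)"
    if xy: "x \<in> carrier G" "y \<in> carrier H" for x y
  proof -
    have "coprime (G.ord x) (H.ord y)"
      using assms(5) G.ord_dvd_group_order[OF xy(1)] H.ord_dvd_group_order[OF xy(2)] coprime_divisors by blast
    then have "P.ord (x, y) = G.ord x * H.ord y"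
      using ord_DirProd[OF assms(1,2) xy] by (simp add: lcm_coprime)
    moreover have "G.ord x \<noteq> 0" "H.ord y \<noteq> 0"
      using G.ord_ge_1[OF assms(3) xy(1)] H.ord_ge_1[OF assms(4) xy(2)] by linarith+
    ultimately show ?thesis using assms(6) by (simp add: prime_elem_multiplicity_mult_distrib)
  qed
  then have "P.rho_exponent q = (\<Sum>x\<in>carrier G. \<Sum>y\<in>carrier H. multiplicity q (G.ord x) + multiplicity q (H.ord y))"
    unfolding P.rho_exponent_def carrier_DirProd sum.cartesian_product[symmetric]
    by (auto simp: sum.cartesian_product intro!: sum.cong)
  then show ?thesis
    by (simp add: sum.distrib G.rho_exponent_def H.rho_exponent_def order_def sum_distrib_left)
qed

lemma (in group) rho_exponent_prime_order:
  assumes p: "prime p" "order G = p" and q: "prime q"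
  shows "rho_exponent q = (if q = p then p - 1 else 0)"
proof -
  have fin: "finite (carrier G)" using p order_gt_0_iff_finite prime_gt_0_nat by metis
  have "multiplicity q (ord x) = (if q = p \<and> x \<noteq> \<one> then 1 else 0)" if x: "x \<in> carrier G" for x
  proof (cases "x = \<one>")
    case False
    then have "ord x = p" using ord_dvd_group_order[OF x] ord_eq_1[OF x] p by (auto simp: prime_nat_iff)
    moreover have "multiplicity q p = (if q = p then 1 else 0)"
      using p q primes_dvd_imp_eq[OF q p(1)] by (auto intro: not_dvd_imp_multiplicity_0)
    ultimately show ?thesis using False by simp
  qed simp
  then have "rho_exponent q = (\<Sum>x\<in>carrier G. if q = p \<and> x \<noteq> \<one> then 1 else 0)"
    unfolding rho_exponent_def by (intro sum.cong) auto
  also have "\<dots> = (if q = p then card (carrier G - {\<one>}) else 0)"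
    using fin by (auto simp: sum.If_cases Int_def set_diff_eq)
  finally show ?thesis using p by (simp add: order_def)
qed

lemma (in order_60_group) rho_exponent_eq_card:
  assumes "r \<in> {2, 3, 5}"
  shows "rho_exponent r = card {g \<in> carrier G. ord g = r}"
proof -
  have pr: "prime (2::nat)" "prime (3::nat)" "prime (5::nat)" by simp_all
  have "multiplicity r (ord g) = (if ord g = r then 1 else 0)" if g: "g \<in> carrier G" for g
    using ords[OF g] assms pr primes_dvd_imp_eq[of r "ord g"]
    by (auto intro!: not_dvd_imp_multiplicity_0)
  then have "rho_exponent r = (\<Sum>g\<in>carrier G. if ord g = r then 1 else 0)"
    unfolding rho_exponent_def by (intro sum.cong) auto
  then show ?thesis using fin by (simp add: sum.If_cases Int_def)
qed

text \<open>The three exponents add up to 59, the number of nonidentity elements. Each of these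
  contributes at least 1 to the sum, hence exactly 1, so its order is prime.\<close>

lemma (in group) order_60_groupI:
  assumes o: "order G = 60" and e: "rho_exponent 2 = 15" "rho_exponent 3 = 20" "rho_exponent 5 = 24"
  shows "order_60_group G"
proof -
  have fin: "finite (carrier G)" using o order_gt_0_iff_finite by simp
  define s where "s g = multiplicity 2 (ord g) + multiplicity 3 (ord g) + multiplicity 5 (ord g)" for g
  have r: "r \<in> {2, 3, 5}" if "prime r" "r dvd ord g" "g \<in> carrier G" for r g
  proof -
    have "r dvd 2 * (2 * (3 * 5))" using dvd_trans[OF that(2) ord_dvd_group_order[OF that(3)]] o by simp
    moreover have "prime (2::nat)" "prime (3::nat)" "prime (5::nat)" by simp_all
    ultimately show ?thesis
      using primes_dvd_imp_eq[OF that(1)] unfolding prime_dvd_mult_iff[OF that(1)] by blast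
  qed
  have mult: "k \<le> multiplicity r (ord g)" if "r ^ k dvd ord g" "prime r" "g \<in> carrier G" for r k g
    using that ord_ge_1[OF fin that(3)] prime_gt_1_nat[OF that(2)] by (intro multiplicity_geI) auto
  have prime_ord: "\<exists>r\<in>{2, 3, 5}. prime r \<and> r dvd ord g" if "g \<in> carrier G - {\<one>}" for g
    using prime_factor_nat[of "ord g"] r that ord_eq_1[of g] by blast
  have s1: "1 \<le> s g" if g: "g \<in> carrier G - {\<one>}" for g
  proof -
    obtain r where "r \<in> {2, 3, 5}" "prime r" "r dvd ord g" using prime_ord[OF g] by blast
    then show ?thesis using mult[of r 1 g] g by (auto simp: s_def)
  qed
  have "(\<Sum>g\<in>carrier G. s g) = 59" using e by (simp add: s_def sum.distrib rho_exponent_def)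
  moreover have "(\<Sum>g\<in>carrier G. s g) = s \<one> + (\<Sum>g\<in>carrier G - {\<one>}. s g)"
    using fin by (intro sum.remove) auto
  moreover have "s \<one> = 0" by (simp add: s_def)
  moreover have "card (carrier G - {\<one>}) = 59" using o by (simp add: order_def)
  ultimately have eq: "(\<Sum>g\<in>carrier G - {\<one>}. 1) = (\<Sum>g\<in>carrier G - {\<one>}. s g)" by simp
  have s_eq: "s g = 1" if g: "g \<in> carrier G - {\<one>}" for g
    using sum_mono_inv[OF eq s1 g] fin by simp
  have ords: "ord g \<in> {1, 2, 3, 5}" if g: "g \<in> carrier G" for g
  proof (cases "g = \<one>")
    case False
    then have g1: "g \<in> carrier G - {\<one>}" using g by simp
    obtain r where r1: "r \<in> {2, 3, 5}" "prime r" "r dvd ord g" using prime_ord[OF g1] by blast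
    then obtain k where k: "ord g = r * k" by blast
    \<comment> \<open>A further prime factor would raise \<open>s g\<close> to at least 2, through
      the multiplicity of \<open>r\<close> if it equals \<open>r\<close> and through a second
      summand otherwise.\<close>
    have "k = 1"
    proof (rule ccontr)
      assume "k \<noteq> 1"
      then obtain r' where r': "prime r'" "r' dvd k" using prime_factor_nat by blast
      then have dv: "r * r' dvd ord g" using k by (simp add: mult_dvd_mono)
      then have r2: "r' \<in> {2, 3, 5}" "r' dvd ord g" using r[OF r'(1) _ g] dvd_mult_right by blast+
      have m1: "1 \<le> multiplicity r (ord g)" "1 \<le> multiplicity r' (ord g)"
        using mult[of r 1 g] mult[of r' 1 g] r1 r2 r' g by simp_all
      have "2 \<le> multiplicity r (ord g)" if "r = r'"
        using mult[of r 2 g] dv r1 g that by (simp add: power2_eq_square)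
      then have "2 \<le> s g" using m1 r1(1) r2(1) by (auto simp: s_def)
      then show False using s_eq[OF g1] by simp
    qed
    then show ?thesis using k r1 by simp
  qed simp
  have "multiplicity 2 (ord g) = (if ord g = 2 then 1 else 0)" if g: "g \<in> carrier G" for g
    using ords[OF g] by (auto intro!: not_dvd_imp_multiplicity_0)
  then have "rho_exponent 2 = (\<Sum>g\<in>carrier G. if ord g = 2 then 1 else 0)"
    unfolding rho_exponent_def by (intro sum.cong) auto
  then have "card (elements_of_order 2) = 15"
    using fin e by (simp add: sum.If_cases Int_def elements_of_order_def)
  then show ?thesis using o ords by unfold_locales auto
qed

lemma order_60_group_PSL_2_5: "order_60_group PSL_2_5"
proof -
  interpret group PSL_2_5 by (rule group_PSL)
  show ?thesis
    using order_PSL_2_5 ord_PSL_2_5 card_ord_PSL_2_5 by unfold_locales (auto simp: elements_of_order_def)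
qed

lemma rho_exponent_PSL_2_5:
  "group.rho_exponent PSL_2_5 2 = 15" "group.rho_exponent PSL_2_5 3 = 20" "group.rho_exponent PSL_2_5 5 = 24"
  using order_60_group.rho_exponent_eq_card[OF order_60_group_PSL_2_5] card_ord_PSL_2_5 by simp_all

text \<open>The cyclic factor multiplies the exponents 15, 20 and 24 by \<open>p\<close> and
  contributes \<open>60 * (p - 1)\<close> at \<open>p\<close>, to which PSL(2,5) adds nothing
  because \<open>p\<close> does not divide 60.\<close>

lemma Exp_rho_PSL_2_5_times:
  assumes p: "prime p" "p > 5"
  shows "Exp_rho (PSL_2_5 \<times>\<times> integer_mod_group p) = {15 * p, 20 * p, 24 * p, 60 * (p - 1)}"
proof -
  let ?P = "PSL_2_5 \<times>\<times> integer_mod_group p"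
  interpret K: order_60_group PSL_2_5 by (rule order_60_group_PSL_2_5)
  interpret P: group ?P by (intro DirProd_group K.is_group group_integer_mod_group)
  have oZ: "order (integer_mod_group p) = p" using p by (simp add: order_def carrier_integer_mod_group)
  have finZ: "finite (carrier (integer_mod_group p))" using p by (simp add: carrier_integer_mod_group)
  have "coprime p 60" using prime_imp_coprime[OF p(1) prime_gt_5_not_dvd_60[OF p]] .
  then have e: "P.rho_exponent q = p * K.rho_exponent q + 60 * (if q = p then p - 1 else 0)" if "prime q" for q
    using rho_exponent_DirProd[OF K.is_group group_integer_mod_group K.fin finZ _ that]
      group.rho_exponent_prime_order[OF group_integer_mod_group p(1) oZ that] K.order_60 oZ
    by (simp add: coprime_commute)
  have pr: "prime (2::nat)" "prime (3::nat)" "prime (5::nat)" by simp_all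
  have "\<not> p dvd order PSL_2_5" using prime_gt_5_not_dvd_60[OF p] K.order_60 by simp
  then have "K.rho_exponent p = 0" using K.rho_exponent_pos_imp_dvd by blast
  then have vals: "P.rho_exponent 2 = 15 * p" "P.rho_exponent 3 = 20 * p" "P.rho_exponent 5 = 24 * p"
    "P.rho_exponent p = 60 * (p - 1)"
    using e[OF pr(1)] e[OF pr(2)] e[OF pr(3)] e[OF p(1)] rho_exponent_PSL_2_5 p by simp_all
  have "{q. prime q \<and> 0 < P.rho_exponent q} = {2, 3, 5, p}"
  proof (intro equalityI subsetI)
    fix q assume "q \<in> {q. prime q \<and> 0 < P.rho_exponent q}"
    then have q: "prime q" "q dvd order ?P" using P.rho_exponent_pos_imp_dvd by auto
    then have "q dvd 2 * (2 * (3 * (5 * p)))"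
      using K.order_60 oZ by (simp add: order_def card_cartesian_product)
    then show "q \<in> {2, 3, 5, p}"
      using primes_dvd_imp_eq[OF q(1)] pr p(1) unfolding prime_dvd_mult_iff[OF q(1)] by blast
  qed (use vals p pr in auto)
  then have "Exp_rho ?P = P.rho_exponent ` {2, 3, 5, p}"
    using Exp_rho_eq_rho_exponent[OF P.is_group] K.fin finZ by simp
  then show ?thesis using vals by simp
qed

theorem theorem2p12:
  fixes p :: nat and G :: "('a, 'b) monoid_scheme"
  assumes "prime p" and "p > 5"
    and "group G" and "finite (carrier G)"
  shows "G \<cong> PSL_2_5 \<times>\<times> integer_mod_group p \<longleftrightarrow>
    Exp_rho G = Exp_rho (PSL_2_5 \<times>\<times> integer_mod_group p)"
proof
  let ?P = "PSL_2_5 \<times>\<times> integer_mod_group p"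
  interpret G: group G by fact
  interpret K: order_60_group PSL_2_5 by (rule order_60_group_PSL_2_5)
  have grpP: "group ?P" by (intro DirProd_group K.is_group group_integer_mod_group)
  have finP: "finite (carrier ?P)" using K.fin assms(2) by (simp add: carrier_integer_mod_group)
  show "Exp_rho G = Exp_rho ?P" if "G \<cong> ?P"
    unfolding Exp_rho_eq_rho_exponent[OF assms(3,4)] Exp_rho_eq_rho_exponent[OF grpP finP]
      rho_exponent_iso[OF assms(3) grpP that] ..
  assume "Exp_rho G = Exp_rho ?P"
  then have "G.rho_exponent ` {q. prime q \<and> 0 < G.rho_exponent q} = {15 * p, 20 * p, 24 * p, 60 * (p - 1)}"
    unfolding Exp_rho_PSL_2_5_times[OF assms(1,2)] Exp_rho_eq_rho_exponent[OF assms(3,4)] .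
  note G = G.order_eq_60_mult[OF assms(4,1,2) this]
  obtain y where y: "y \<in> carrier G" "G.ord y = p" "G.centralizer y = carrier G"
    using G.exists_central_element[OF assms(4,1,2) G(1,2,4,5)] by blast
  have "coprime p 60" using prime_imp_coprime[OF assms(1) prime_gt_5_not_dvd_60[OF assms(1,2)]] .
  then have cop: "coprime 60 p" by (simp add: coprime_commute)
  obtain H where H: "subgroup H G" "card H = 60" "G\<lparr>carrier := H\<rparr> \<times>\<times> integer_mod_group p \<cong> G"
    using G.central_complement[OF assms(4) y G(1) cop] by blast
  let ?H = "G\<lparr>carrier := H\<rparr>"
  interpret H: group ?H using G.subgroup_imp_group[OF H(1)] .
  have oH: "order ?H = 60" and oZ: "order (integer_mod_group p) = p"
    using H(2) assms(2) by (simp_all add: order_def carrier_integer_mod_group)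
  have fins: "finite (carrier ?H)" "finite (carrier (integer_mod_group p))"
    using H(2) card.infinite[of H] assms(2) by (force simp: carrier_integer_mod_group)+
  have pr: "prime (2::nat)" "prime (3::nat)" "prime (5::nat)" by simp_all
  \<comment> \<open>Away from \<open>p\<close> the cyclic factor has exponent 0, so cancelling
    \<open>p\<close> from 15p, 20p and 24p recovers the exponents of the complement.\<close>
  have e: "G.rho_exponent q = p * H.rho_exponent q" if q: "prime q" "q \<noteq> p" for q
    using rho_exponent_iso[OF DirProd_group[OF H.is_group group_integer_mod_group] assms(3) H(3), of q]
      rho_exponent_DirProd[OF H.is_group group_integer_mod_group fins _ q(1)]
      group.rho_exponent_prime_order[OF group_integer_mod_group assms(1) oZ q(1)] oH oZ cop q(2)
    by simp
  have "order_60_group ?H"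
    using e[OF pr(1)] e[OF pr(2)] e[OF pr(3)] G assms(2) by (intro H.order_60_groupI oH) auto
  then have "?H \<cong> alt_group 5" by (rule order_60_group.iso_alt_group_5)
  also have "alt_group 5 \<cong> PSL_2_5" using K.iso_sym[OF K.iso_alt_group_5] .
  finally have "?H \<times>\<times> integer_mod_group p \<cong> ?P"
    by (rule H.DirProd_iso_trans) (rule iso_refl)
  moreover have "G \<cong> ?H \<times>\<times> integer_mod_group p"
    using group.iso_sym[OF DirProd_group[OF H.is_group group_integer_mod_group] H(3)] .
  ultimately show "G \<cong> ?P" using iso_trans by blast
qed

end
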